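(* Let $d \in \{1,2,3\}$ and let $G=(V,E)$ be a finite chordal graph which is a $d$-sphere graph, with $|V| \geq d+1$. Then the following are equivalent: (1) $G$ is globally $d$-sphere-rigid; (2) $G$ is $d$-sphere-rigid; (3) $G$ is $d$-connected; (4) $|E| = d|V| - \binom{d+1}{2}$; (5) $G$ is a $d$-tree.
   Context: A $d$-sphere realisation of a graph $G=(V,E)$ is a map $\rho: V \to \mathbb{R}^d$ such that $\|\rho(v)-\rho(w)\| = 1$ whenever $vw \in E$ and $\|\rho(v)-\rho(w)\| > 1$ whenever $v \neq w$ and $vw \notin E$ (i.e. $G$ is the contact graph of a collection of equal-size balls with pairwise non-overlapping interiors centred at the points $\rho(v)$). A graph is a $d$-sphere graph if it has at least one $d$-sphere realisation. A $d$-sphere graph $G$ is $d$-sphere-rigid if it has only finitely many $d$-sphere realisations modulo Euclidean isometries of $\mathbb{R}^d$, and globally $d$-sphere-rigid if it has exactly one $d$-sphere realisation modulo Euclidean isometries of $\mathbb{R}^d$. A graph is chordal if every induced cycle is a triangle. A graph is a $d$-tree if it can be obtained from the complete graph $K_{d+1}$ by repeatedly adding a new vertex of degree $d$ whose neighbour set induces a copy of $K_d$. *)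

theory Defs
  imports "HOL-Analysis.Analysis"
begin

text \<open>A finite simple graph is given by its vertex set \<open>V\<close> and its set \<open>E\<close> of undirected
  edges, each edge being a two-element subset of \<open>V\<close>.\<close>

definition fin_graph :: "'a set \<Rightarrow> 'a set set \<Rightarrow> bool" where
  "fin_graph V E \<longleftrightarrow> finite V \<and> (\<forall>e\<in>E. e \<subseteq> V \<and> card e = 2)"

definition induced_edges :: "'a set set \<Rightarrow> 'a set \<Rightarrow> 'a set set" where
  "induced_edges E W = {e \<in> E. e \<subseteq> W}"

definition complete_edges :: "'a set \<Rightarrow> 'a set set" where
  "complete_edges W = {e. e \<subseteq> W \<and> card e = 2}"

definition graph_connected :: "'a set \<Rightarrow> 'a set set \<Rightarrow> bool" where
  "graph_connected V E \<longleftrightarrow>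
     V \<noteq> {} \<and> (\<forall>u\<in>V. \<forall>v\<in>V. (u, v) \<in> {(x, y). x \<in> V \<and> y \<in> V \<and> {x, y} \<in> E}\<^sup>*)"

text \<open>Vertex connectivity in the usual sense: more than \<open>k\<close> vertices, and no set of fewer than
  \<open>k\<close> vertices disconnects the graph. In particular the complete graph on \<open>k + 1\<close> vertices
  is \<open>k\<close>-connected.\<close>

definition k_connected :: "nat \<Rightarrow> 'a set \<Rightarrow> 'a set set \<Rightarrow> bool" where
  "k_connected k V E \<longleftrightarrow>
     card V > k \<and>
     (\<forall>X. X \<subseteq> V \<and> card X < k \<longrightarrow> graph_connected (V - X) (induced_edges E (V - X)))"

text \<open>The list \<open>c\<close> enumerates the vertices of the cycle in cyclic order; the only edges of the
  graph among them are those joining cyclically consecutive vertices.\<close>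

definition induced_cycle :: "'a set \<Rightarrow> 'a set set \<Rightarrow> 'a list \<Rightarrow> bool" where
  "induced_cycle V E c \<longleftrightarrow>
     3 \<le> length c \<and> distinct c \<and> set c \<subseteq> V \<and>
     (\<forall>i<length c. \<forall>j<length c.
        {c ! i, c ! j} \<in> E \<longleftrightarrow> j = Suc i mod length c \<or> i = Suc j mod length c)"

definition chordal :: "'a set \<Rightarrow> 'a set set \<Rightarrow> bool" where
  "chordal V E \<longleftrightarrow> (\<forall>c. induced_cycle V E c \<longrightarrow> length c = 3)"

inductive d_tree :: "nat \<Rightarrow> 'a set \<Rightarrow> 'a set set \<Rightarrow> bool" for d :: nat where
  complete: "finite V \<Longrightarrow> card V = d + 1 \<Longrightarrow> d_tree d V (complete_edges V)"
| add_vertex: "d_tree d V E \<Longrightarrow> v \<notin> V \<Longrightarrow> N \<subseteq> V \<Longrightarrow> card N = d \<Longrightarrow>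
     induced_edges E N = complete_edges N \<Longrightarrow>
     d_tree d (insert v V) (E \<union> {{v, u} | u. u \<in> N})"

text \<open>The dimension \<open>d\<close> of the ambient Euclidean space is \<open>CARD('d)\<close>. A realisation is a map
  with domain \<open>V\<close>, so it is taken to be \<open>undefined\<close> outside \<open>V\<close>; otherwise its
  irrelevant values there would spoil the counting of realisations below.\<close>

definition sphere_realisations :: "'a set \<Rightarrow> 'a set set \<Rightarrow> ('a \<Rightarrow> real ^ 'd) set" where
  "sphere_realisations V E =
     {\<rho> \<in> V \<rightarrow>\<^sub>E UNIV.
        \<forall>v\<in>V. \<forall>w\<in>V.
          ({v, w} \<in> E \<longrightarrow> norm (\<rho> v - \<rho> w) = 1) \<and>
          (v \<noteq> w \<and> {v, w} \<notin> E \<longrightarrow> norm (\<rho> v - \<rho> w) > 1)}"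

definition sphere_graph :: "'d::finite itself \<Rightarrow> 'a set \<Rightarrow> 'a set set \<Rightarrow> bool" where
  "sphere_graph _ V E \<longleftrightarrow> (sphere_realisations V E :: ('a \<Rightarrow> real ^ 'd) set) \<noteq> {}"

definition euclidean_isometry :: "(real ^ 'd \<Rightarrow> real ^ 'd) \<Rightarrow> bool" where
  "euclidean_isometry f \<longleftrightarrow> bij f \<and> (\<forall>x y. dist (f x) (f y) = dist x y)"

definition congruence_rel :: "'a set \<Rightarrow> 'a set set \<Rightarrow> (('a \<Rightarrow> real ^ 'd) \<times> ('a \<Rightarrow> real ^ 'd)) set" where
  "congruence_rel V E =
     {(\<rho>, \<sigma>). \<rho> \<in> sphere_realisations V E \<and> \<sigma> \<in> sphere_realisations V E \<and>
        (\<exists>f. euclidean_isometry f \<and> (\<forall>v\<in>V. \<sigma> v = f (\<rho> v)))}"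

lemma equiv_congruence_rel:
  fixes V :: "'a set"
  shows "equiv (sphere_realisations V E :: ('a \<Rightarrow> real ^ 'd::finite) set) (congruence_rel V E)"
proof (rule equivI)
  show "(congruence_rel V E :: (('a \<Rightarrow> real ^ 'd) \<times> ('a \<Rightarrow> real ^ 'd)) set) \<subseteq> sphere_realisations V E \<times> sphere_realisations V E"
    by (auto simp: congruence_rel_def)
  show "refl_on (sphere_realisations V E :: ('a \<Rightarrow> real ^ 'd) set) (congruence_rel V E)"
    unfolding refl_on_def congruence_rel_def euclidean_isometry_def
    by (auto intro!: exI[of _ id])
  show "sym (congruence_rel V E :: (('a \<Rightarrow> real ^ 'd) \<times> ('a \<Rightarrow> real ^ 'd)) set)"
  proof (rule symI)
    fix \<rho> \<sigma> :: "'a \<Rightarrow> real ^ 'd"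
    assume a: "(\<rho>, \<sigma>) \<in> congruence_rel V E"
    then obtain f where f: "euclidean_isometry f" "\<forall>v\<in>V. \<sigma> v = f (\<rho> v)"
      by (auto simp: congruence_rel_def)
    have "bij f" using f by (simp add: euclidean_isometry_def)
    then have "dist (inv f x) (inv f y) = dist x y" for x y
      using f(1) unfolding euclidean_isometry_def by (metis bij_inv_eq_iff)
    then have "euclidean_isometry (inv f)"
      using \<open>bij f\<close> by (simp add: euclidean_isometry_def bij_imp_bij_inv)
    moreover have "\<forall>v\<in>V. \<rho> v = inv f (\<sigma> v)"
      using f(2) \<open>bij f\<close> by (simp add: bij_is_inj)
    ultimately show "(\<sigma>, \<rho>) \<in> congruence_rel V E"
      using a by (auto simp: congruence_rel_def)
  qed
  show "trans (congruence_rel V E :: (('a \<Rightarrow> real ^ 'd) \<times> ('a \<Rightarrow> real ^ 'd)) set)"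
  proof (rule transI)
    fix \<rho> \<sigma> \<tau> :: "'a \<Rightarrow> real ^ 'd"
    assume a: "(\<rho>, \<sigma>) \<in> congruence_rel V E" "(\<sigma>, \<tau>) \<in> congruence_rel V E"
    then obtain f g where fg: "euclidean_isometry f" "\<forall>v\<in>V. \<sigma> v = f (\<rho> v)"
        "euclidean_isometry g" "\<forall>v\<in>V. \<tau> v = g (\<sigma> v)"
      by (auto simp: congruence_rel_def)
    have "euclidean_isometry (g \<circ> f)"
      using fg by (auto simp: euclidean_isometry_def intro: bij_comp)
    then show "(\<rho>, \<tau>) \<in> congruence_rel V E"
      using a fg by (auto simp: congruence_rel_def intro!: exI[of _ "g \<circ> f"])
  qed
qed

definition realisation_classes :: "'a set \<Rightarrow> 'a set set \<Rightarrow> ('a \<Rightarrow> real ^ 'd) set set" where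
  "realisation_classes V E = sphere_realisations V E // congruence_rel V E"

definition sphere_rigid :: "'d::finite itself \<Rightarrow> 'a set \<Rightarrow> 'a set set \<Rightarrow> bool" where
  "sphere_rigid T V E \<longleftrightarrow>
     sphere_graph T V E \<and> finite (realisation_classes V E :: ('a \<Rightarrow> real ^ 'd) set set)"

definition globally_sphere_rigid :: "'d::finite itself \<Rightarrow> 'a set \<Rightarrow> 'a set set \<Rightarrow> bool" where
  "globally_sphere_rigid T V E \<longleftrightarrow>
     sphere_graph T V E \<and> card (realisation_classes V E :: ('a \<Rightarrow> real ^ 'd) set set) = 1"

end

theory Submission
  imports Defs
begin

text \<open>A chordal graph is dismantled by removing simplicial vertices, whose neighbourhoods in a
  \<open>d\<close>-sphere graph have at most \<open>d\<close> elements because a clique is realised as a regular simplex.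
  Rebuilding the graph, either every new vertex is attached to \<open>d\<close> older ones and the graph is a
  \<open>d\<close>-tree, or some vertex is attached to a clique \<open>X\<close> with fewer than \<open>d\<close> elements, which then
  separates the final graph. In the second case one side can be rotated about the affine hull of
  \<open>X\<close>, of dimension at most \<open>d - 2\<close>, and points off this hull on both sides show that the resulting
  realisations are not congruent. In a \<open>d\<close>-tree the new vertex has only two possible positions,
  mirror images in the facet spanned by its neighbours, and one of them is already taken.\<close>

section \<open>Simplicial vertices of chordal graphs\<close>


text \<open>The edge count needs an induction of its own, since it says nothing directly about
  separations: each eliminated vertex takes away at most d edges, so attaining the bound forces
  every attachment to be to a clique of d vertices. The flex respects all contacts because none
  joins the two sides, and the strict inequalities across the cut are finitely many open conditions.
  The delicate point is to exclude a motion that only looks like a flex: some distance between the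
  two sides must change for arbitrarily small parameters, which requires a rotation plane onto which
  a point of either side projects nontrivially.\<close>

text \<open>A walk of least length has no repeated vertex and no chord, since either would shorten
  it.\<close>

lemma induced_path_exists:
  assumes "sym R" and irr: "\<And>x. (x, x) \<notin> R" and st: "(s, t) \<in> R\<^sup>*"
  obtains p where "p \<noteq> []" "hd p = s" "last p = t" "distinct p"
    "\<And>i j. i < length p \<Longrightarrow> j < length p \<Longrightarrow> (p ! i, p ! j) \<in> R \<longleftrightarrow> j = Suc i \<or> i = Suc j"
proof -
  define walk where "walk p \<longleftrightarrow> p \<noteq> [] \<and> hd p = s \<and> last p = t \<and>
    (\<forall>i. Suc i < length p \<longrightarrow> (p ! i, p ! Suc i) \<in> R)" for p
  have "\<exists>p. walk p"
    using st unfolding walk_def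
  proof (induction rule: rtrancl_induct)
    case base
    show ?case by (rule exI[of _ "[s]"]) simp
  next
    case (step y z)
    then obtain p where p: "p \<noteq> []" "hd p = s" "last p = y"
      "\<forall>i. Suc i < length p \<longrightarrow> (p ! i, p ! Suc i) \<in> R" by blast
    have "((p @ [z]) ! i, (p @ [z]) ! Suc i) \<in> R" if "Suc i < length (p @ [z])" for i
    proof (cases "Suc i < length p")
      case True
      then show ?thesis using p by (simp add: nth_append)
    next
      case False
      then have "i = length p - 1" "Suc i = length p" using that by auto
      then show ?thesis using p step by (simp add: nth_append last_conv_nth)
    qed
    then show ?case using p by (intro exI[of _ "p @ [z]"]) simp
  qed
  then obtain p where p: "walk p" and least: "\<And>q. walk q \<Longrightarrow> length p \<le> length q"
    using ex_has_least_nat[of walk _ length] by blast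
  have ne: "p \<noteq> []" and hd: "hd p = s" and last: "last p = t"
    and step: "\<And>i. Suc i < length p \<Longrightarrow> (p ! i, p ! Suc i) \<in> R"
    using p by (auto simp: walk_def)
  \<comment> \<open>Follow the walk to position i and resume at k. The value
    \<open>k = length p\<close> means stopping at i, which covers a repetition of the final
    vertex.\<close>
  have shortcut: False
    if ik: "Suc i < k" "k \<le> length p" and R: "k < length p \<Longrightarrow> (p ! i, p ! k) \<in> R"
      and fin: "k = length p \<Longrightarrow> p ! i = t" for i k
  proof -
    define q where "q = take (Suc i) p @ drop k p"
    have len: "length q = Suc i + (length p - k)" using ik by (simp add: q_def)
    have nth: "q ! l = (if l < Suc i then p ! l else p ! (k + (l - Suc i)))" if "l < length q" for l
      using that ik unfolding q_def by (auto simp: nth_append)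
    have "walk q"
      unfolding walk_def
    proof (intro conjI allI impI)
      show "q \<noteq> []" "hd q = s" using ne hd by (auto simp: q_def)
      show "last q = t"
      proof (cases "k = length p")
        case True
        then show ?thesis using fin ik ne by (simp add: q_def take_Suc_conv_app_nth)
      next
        case False
        then show ?thesis using last ik by (simp add: q_def)
      qed
      fix l assume l: "Suc l < length q"
      consider "Suc l < Suc i" | "l = i" | "i < l" by linarith
      then show "(q ! l, q ! Suc l) \<in> R"
      proof cases
        case 1
        then show ?thesis using l ik step[of l] by (simp add: nth)
      next
        case 2
        then show ?thesis using l len R by (simp add: nth)
      next
        case 3
        then have "Suc (k + (l - Suc i)) = k + (l - i)" by simp
        moreover have "k + (l - i) < length p" using 3 l len by simp
        ultimately show ?thesis using l 3 step[of "k + (l - Suc i)"] by (simp add: nth)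
      qed
    qed
    then show False using least[of q] len ik by simp
  qed
  have neq: "p ! i \<noteq> p ! j" if "i < j" "j < length p" for i j
  proof
    assume eq: "p ! i = p ! j"
    show False
    proof (rule shortcut[of i "Suc j"])
      show "(p ! i, p ! Suc j) \<in> R" if "Suc j < length p"
        using step[OF that] eq by simp
      show "p ! i = t" if "Suc j = length p"
        using that eq last ne by (simp add: last_conv_nth flip: that)
    qed (use that in auto)
  qed
  have chordless: "(p ! i, p ! j) \<in> R \<longleftrightarrow> j = Suc i" if "i < j" "j < length p" for i j
  proof (cases "j = Suc i")
    case True
    then show ?thesis using step that by simp
  next
    case False
    then show ?thesis using shortcut[of i j] that by auto
  qed
  show thesis
  proof (rule that[OF ne hd last])
    show "distinct p"
      unfolding distinct_conv_nth using neq by (metis nat_neq_iff)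
    show "(p ! i, p ! j) \<in> R \<longleftrightarrow> j = Suc i \<or> i = Suc j" if "i < length p" "j < length p" for i j
    proof -
      have "(p ! i, p ! j) \<in> R \<longleftrightarrow> (p ! j, p ! i) \<in> R" using \<open>sym R\<close> by (auto dest: symD)
      then show ?thesis
        using chordless[of i j] chordless[of j i] irr that
        by (cases i j rule: linorder_cases) auto
    qed
  qed
qed

definition clique :: "'a set set \<Rightarrow> 'a set \<Rightarrow> bool" where
  "clique E K \<longleftrightarrow> (\<forall>x\<in>K. \<forall>y\<in>K. x \<noteq> y \<longrightarrow> {x, y} \<in> E)"

definition nbrs :: "'a set set \<Rightarrow> 'a set \<Rightarrow> 'a \<Rightarrow> 'a set" where
  "nbrs E W v = {w \<in> W. {v, w} \<in> E}"

lemma clique_subset: "clique E K \<Longrightarrow> L \<subseteq> K \<Longrightarrow> clique E L"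
  by (auto simp: clique_def)

lemma clique_insert_nbrs: "clique E N \<Longrightarrow> N \<subseteq> nbrs E W v \<Longrightarrow> clique E (insert v N)"
  by (auto simp: clique_def nbrs_def insert_commute)

lemma chordal_subset: "chordal V E \<Longrightarrow> W \<subseteq> V \<Longrightarrow> chordal W E"
  by (auto simp: chordal_def induced_cycle_def)

text \<open>This is the source of contradictions with chordality: once the path has three vertices,
  the cycle has at least four.\<close>

lemma induced_cycle_of_path:
  assumes card2: "\<And>e. e \<in> E \<Longrightarrow> card e = 2"
    and p: "2 \<le> length p" "distinct p" "u \<notin> set p" "insert u (set p) \<subseteq> V"
    and path: "\<And>i j. i < length p \<Longrightarrow> j < length p \<Longrightarrow>
      {p ! i, p ! j} \<in> E \<longleftrightarrow> j = Suc i \<or> i = Suc j"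
    and apex: "\<And>i. i < length p \<Longrightarrow> {u, p ! i} \<in> E \<longleftrightarrow> i = 0 \<or> Suc i = length p"
  shows "induced_cycle V E (u # p)"
proof -
  have irr: "{x} \<notin> E" for x using card2[of "{x}"] by auto
  let ?n = "length p"
  have "{(u # p) ! i, (u # p) ! j} \<in> E \<longleftrightarrow> j = Suc i mod Suc ?n \<or> i = Suc j mod Suc ?n"
    if ij: "i < Suc ?n" "j < Suc ?n" for i j
  proof -
    have S: "Suc k mod Suc ?n = (if k = ?n then 0 else Suc k)" if "k < Suc ?n" for k
      using that by auto
    show ?thesis
    proof (cases i; cases j)
      assume "i = 0" "j = 0"
      then show ?thesis using irr p S[of 0] by auto
    next
      fix j' assume j': "i = 0" "j = Suc j'"
      then show ?thesis using apex[of j'] ij p S[of 0] S[of j] by auto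
    next
      fix i' assume i': "i = Suc i'" "j = 0"
      moreover have "{p ! i', u} = {u, p ! i'}" by auto
      ultimately show ?thesis using apex[of i'] ij p S[of 0] S[of i] by auto
    next
      fix i' j' assume i'j': "i = Suc i'" "j = Suc j'"
      have "j = Suc i mod Suc ?n \<longleftrightarrow> j' = Suc i'"
        unfolding S[OF ij(1)] using i'j' ij by auto
      moreover have "i = Suc j mod Suc ?n \<longleftrightarrow> i' = Suc j'"
        unfolding S[OF ij(2)] using i'j' ij by auto
      ultimately show ?thesis using path[of i' j'] i'j' ij by simp
    qed
  qed
  then show ?thesis using p by (simp add: induced_cycle_def)
qed

text \<open>Dirac's theorem in a form that supports induction on the vertex set: the neighbourhood of a
  component \<open>C\<close> of the graph outside \<open>u\<close> and its neighbours is a clique, and a vertex of \<open>C\<close> that is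
  simplicial in \<open>C\<close> together with this clique is simplicial in the whole graph.\<close>

lemma chordal_simplicial_nonneighbour:
  assumes "finite W" "chordal W E" and card2: "\<And>e. e \<in> E \<Longrightarrow> card e = 2"
    and "u \<in> W" "w \<in> W" "w \<noteq> u" "{u, w} \<notin> E"
  shows "\<exists>v\<in>W. v \<noteq> u \<and> {u, v} \<notin> E \<and> clique E (nbrs E W v)"
  using assms(1,2,4-)
proof (induction W arbitrary: u w rule: finite_psubset_induct)
  case (psubset W)
  have irr: "{x} \<notin> E" for x using card2[of "{x}"] by auto
  define M where "M = {x \<in> W. x \<noteq> u \<and> {u, x} \<notin> E}"
  define R where "R = {(x, y). x \<in> M \<and> y \<in> M \<and> {x, y} \<in> E}"
  define C where "C = {x. (w, x) \<in> R\<^sup>*}"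
  \<comment> \<open>The boundary of the component C. A vertex of it other than u that is not
    adjacent to u would lie in M and hence in C.\<close>
  define S where "S = {s \<in> W - C. \<exists>c\<in>C. {s, c} \<in> E}"
  have w: "w \<in> M" using psubset.prems by (simp add: M_def)
  have wC: "w \<in> C" by (simp add: C_def)
  have CM: "C \<subseteq> M"
  proof
    fix x assume "x \<in> C"
    then have "(w, x) \<in> R\<^sup>*" by (simp add: C_def)
    then show "x \<in> M" by (cases rule: rtranclE) (use w in \<open>auto simp: R_def\<close>)
  qed
  have closed: "y \<in> C" if "x \<in> C" "y \<in> M" "{x, y} \<in> E" for x y
  proof -
    have "(x, y) \<in> R" using that CM by (auto simp: R_def)
    then show ?thesis using that(1) by (auto simp: C_def intro: rtrancl_into_rtrancl)
  qed
  have Su: "{u, s} \<in> E \<and> s \<noteq> u" if "s \<in> S" for s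
    using that closed CM unfolding S_def M_def by (auto simp: insert_commute)
  \<comment> \<open>Two nonadjacent vertices of S are joined by an induced path whose inner vertices
    lie in C. As u is adjacent to its ends and to nothing in C, adding u closes an induced cycle of
    length at least four.\<close>
  have clS: "clique E S"
    unfolding clique_def
  proof (intro ballI impI, rule ccontr)
    fix s t assume s: "s \<in> S" and t: "t \<in> S" and st: "s \<noteq> t" "{s, t} \<notin> E"
    let ?T = "C \<union> {s, t}"
    define Q where "Q = {(x, y). x \<in> ?T \<and> y \<in> ?T \<and> {x, y} \<in> E}"
    have symQ: "sym Q" by (auto simp: Q_def sym_def insert_commute)
    have wQ: "(w, x) \<in> Q\<^sup>*" if "x \<in> C" for x
    proof -
      have "(w, x) \<in> R\<^sup>*" using that by (simp add: C_def)
      then show ?thesis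
      proof (induction rule: rtrancl_induct)
        case (step y z)
        then have "y \<in> C" "z \<in> C"
          by (auto simp: C_def intro: rtrancl_into_rtrancl)
        then have "(y, z) \<in> Q" using step by (auto simp: Q_def R_def)
        with step.IH show ?case by (rule rtrancl_into_rtrancl)
      qed simp
    qed
    have wS: "(w, x) \<in> Q\<^sup>*" if "x \<in> {s, t}" for x
    proof -
      have "x \<in> S" using that s t by auto
      then obtain c where "c \<in> C" "{x, c} \<in> E" by (auto simp: S_def)
      then have "(c, x) \<in> Q" using that by (auto simp: Q_def insert_commute)
      then show ?thesis using wQ[OF \<open>c \<in> C\<close>] by (rule rtrancl_into_rtrancl[rotated])
    qed
    have "(s, t) \<in> Q\<^sup>*"
      using wS[of s] wS[of t] symD[OF sym_rtrancl[OF symQ]] by (auto intro: rtrancl_trans)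
    then obtain p where p: "p \<noteq> []" "hd p = s" "last p = t" "distinct p"
      and pQ: "\<And>i j. i < length p \<Longrightarrow> j < length p \<Longrightarrow> (p ! i, p ! j) \<in> Q \<longleftrightarrow> j = Suc i \<or> i = Suc j"
      using induced_path_exists[OF symQ] irr by (auto simp: Q_def)
    have hd0: "p ! 0 = s" and lastn: "p ! (length p - 1) = t"
      using p by (simp_all add: hd_conv_nth last_conv_nth)
    have len2: "2 \<le> length p"
    proof (rule ccontr)
      assume "\<not> 2 \<le> length p"
      then have "length p - 1 = 0" by simp
      then show False using hd0 lastn st by simp
    qed
    have len3: "3 \<le> length p"
    proof (rule ccontr)
      assume "\<not> 3 \<le> length p"
      then have "length p = 2" using len2 by simp
      then show False using pQ[of 0 1] hd0 lastn st by (simp add: Q_def)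
    qed
    have inT: "p ! i \<in> ?T" if "i < length p" for i
    proof (cases "Suc i < length p")
      case True
      then show ?thesis using pQ[of i "Suc i"] that by (auto simp: Q_def)
    next
      case False
      then have "i = length p - 1" using that by simp
      then show ?thesis using lastn by simp
    qed
    have "induced_cycle W E (u # p)"
    proof (rule induced_cycle_of_path)
      show "u \<notin> set p"
        using inT Su s t CM by (fastforce simp: in_set_conv_nth M_def)
      show "insert u (set p) \<subseteq> W"
        using inT s t CM \<open>u \<in> W\<close> by (fastforce simp: in_set_conv_nth M_def S_def)
      show "{p ! i, p ! j} \<in> E \<longleftrightarrow> j = Suc i \<or> i = Suc j" if "i < length p" "j < length p" for i j
        using pQ[OF that] inT[OF that(1)] inT[OF that(2)] by (auto simp: Q_def)
      show "{u, p ! i} \<in> E \<longleftrightarrow> i = 0 \<or> Suc i = length p" if i: "i < length p" for i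
      proof (cases "i = 0 \<or> Suc i = length p")
        case True
        then have "i = 0 \<or> i = length p - 1" by auto
        then have "p ! i \<in> {s, t}" using hd0 lastn by auto
        then show ?thesis using True Su s t by auto
      next
        case False
        then have "p ! i \<noteq> p ! 0" "p ! i \<noteq> p ! (length p - 1)"
          using i p by (auto simp: nth_eq_iff_index_eq)
        then have "p ! i \<in> C" using inT[OF i] hd0 lastn by auto
        then show ?thesis using False CM by (auto simp: M_def)
      qed
    qed (use p len2 card2 in auto)
    then show False using \<open>chordal W E\<close> len3 by (auto simp: chordal_def)
  qed
  \<comment> \<open>The vertex u is missing here, which makes the induction hypothesis
    available.\<close>
  let ?H = "C \<union> S"
  have "?H \<subset> W"
    using CM Su \<open>u \<in> W\<close> by (auto simp: S_def M_def)
  then have "chordal ?H E" using \<open>chordal W E\<close> chordal_subset by blast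
  note IH = psubset.IH[OF \<open>?H \<subset> W\<close> this]
  have nbrsC: "nbrs E W c = nbrs E ?H c" if "c \<in> C" for c
    using that CM \<open>?H \<subset> W\<close> by (auto simp: nbrs_def S_def insert_commute)
  \<comment> \<open>The vertex must lie in C, not in S. If some s in S misses a vertex of
    \<open>?H\<close>, the induction hypothesis with s in the role of u gives a vertex not adjacent
    to s, hence outside the clique S. Otherwise S is joined to all of \<open>?H\<close>, and a
    vertex not adjacent to some c in C lies outside S.\<close>
  have "\<exists>v\<in>C. clique E (nbrs E ?H v)"
  proof (cases "clique E ?H")
    case True
    moreover have "nbrs E ?H w \<subseteq> ?H" by (auto simp: nbrs_def)
    ultimately show ?thesis using wC clique_subset by blast
  next
    case False
    show ?thesis
    proof (cases "\<exists>s\<in>S. \<exists>y\<in>?H. y \<noteq> s \<and> {s, y} \<notin> E")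
      case True
      then obtain s y where s: "s \<in> S" "y \<in> ?H" "y \<noteq> s" "{s, y} \<notin> E" by blast
      then obtain v where "v \<in> ?H" "v \<noteq> s" "{s, v} \<notin> E" "clique E (nbrs E ?H v)"
        using IH[of s y] by auto
      then show ?thesis using clS s by (auto simp: clique_def)
    next
      case univ: False
      then obtain c y where c: "c \<in> C" "y \<in> ?H" "y \<noteq> c" "{c, y} \<notin> E"
        using False clS unfolding clique_def by (metis UnE insert_commute)
      then obtain v where "v \<in> ?H" "v \<noteq> c" "{c, v} \<notin> E" "clique E (nbrs E ?H v)"
        using IH[of c y] by auto
      moreover have "v \<notin> S" using univ c calculation by (metis UnI1 insert_commute)
      ultimately show ?thesis by auto
    qed
  qed
  then obtain v where "v \<in> C" "clique E (nbrs E W v)" using nbrsC by auto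
  then show ?case using CM by (auto simp: M_def)
qed

lemma chordal_simplicial_exists:
  assumes "finite W" "chordal W E" "\<And>e. e \<in> E \<Longrightarrow> card e = 2" "W \<noteq> {}"
  shows "\<exists>v\<in>W. clique E (nbrs E W v)"
proof (cases "clique E W")
  case True
  moreover have "nbrs E W v \<subseteq> W" for v by (auto simp: nbrs_def)
  ultimately show ?thesis using assms(4) clique_subset by blast
next
  case False
  then obtain u w where "u \<in> W" "w \<in> W" "w \<noteq> u" "{u, w} \<notin> E" by (auto simp: clique_def)
  then show ?thesis using chordal_simplicial_nonneighbour[OF assms(1-3)] by blast
qed

section \<open>Trees and clique separations\<close>


lemma clique_iff_induced_complete:
  assumes "\<And>e. e \<in> E \<Longrightarrow> card e = 2"
  shows "clique E N \<longleftrightarrow> induced_edges E N = complete_edges N"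
proof
  assume "clique E N"
  then show "induced_edges E N = complete_edges N"
    using assms by (auto simp: clique_def induced_edges_def complete_edges_def card_2_iff)
next
  assume eq: "induced_edges E N = complete_edges N"
  have "{x, y} \<in> complete_edges N" if "x \<in> N" "y \<in> N" "x \<noteq> y" for x y
    using that by (auto simp: complete_edges_def)
  then show "clique E N"
    unfolding clique_def eq[symmetric] by (auto simp: induced_edges_def)
qed

lemma induced_edges_insert:
  assumes "\<And>e. e \<in> E \<Longrightarrow> card e = 2" "v \<notin> W"
  shows "induced_edges E (insert v W) = induced_edges E W \<union> {{v, u} | u. u \<in> nbrs E W v}"
proof (intro equalityI subsetI)
  fix e assume e: "e \<in> induced_edges E (insert v W)"
  show "e \<in> induced_edges E W \<union> {{v, u} | u. u \<in> nbrs E W v}"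
  proof (cases "v \<in> e")
    case True
    then obtain u where "e = {v, u}" "u \<noteq> v"
      using e assms(1)[of e] by (auto simp: induced_edges_def card_2_iff)
    then show ?thesis using e by (auto simp: induced_edges_def nbrs_def)
  qed (use e in \<open>auto simp: induced_edges_def\<close>)
qed (auto simp: induced_edges_def nbrs_def)

lemma card_add_star:
  assumes "finite W" "v \<notin> W" "N \<subseteq> W" "\<And>e. e \<in> F \<Longrightarrow> e \<subseteq> W"
  shows "card (F \<union> {{v, u} | u. u \<in> N}) = card F + card N"
proof -
  have "{{v, u} | u. u \<in> N} = (\<lambda>u. {v, u}) ` N" by auto
  moreover have "inj_on (\<lambda>u. {v, u}) N" by (auto simp: inj_on_def doubleton_eq_iff)
  moreover have "F \<subseteq> Pow W" using assms(4) by auto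
  then have "finite F" using assms(1) by (simp add: finite_subset)
  moreover have "finite N" using assms by (auto intro: finite_subset)
  moreover have "F \<inter> (\<lambda>u. {v, u}) ` N = {}" using assms by auto
  ultimately show ?thesis by (simp add: card_Un_disjoint card_image)
qed

section \<open>Cliques, edge count and connectivity of d-trees\<close>

lemma d_tree_fin_graph: "d_tree d V E \<Longrightarrow> fin_graph V E"
proof (induction rule: d_tree.induct)
  case (complete V)
  then show ?case by (auto simp: fin_graph_def complete_edges_def)
next
  case (add_vertex V E v N)
  have "card {v, u} = 2" if "u \<in> N" for u
    using that add_vertex by (metis card_2_iff subsetD)
  then show ?case using add_vertex by (auto simp: fin_graph_def)
qed

lemma d_tree_clique: "d_tree d V E \<Longrightarrow> \<exists>K\<subseteq>V. clique E K \<and> card K = d + 1"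
proof (induction rule: d_tree.induct)
  case (complete V)
  then show ?case by (intro exI[of _ V]) (auto simp: clique_def complete_edges_def)
next
  case (add_vertex V E v N)
  then obtain K where "K \<subseteq> V" "clique E K" "card K = d + 1" by blast
  then show ?case by (intro exI[of _ K]) (auto simp: clique_def)
qed

text \<open>The vertex w will occupy one of the two positions over N. If N contains the newest
  vertex v, it lies in \<open>insert v M\<close>, which has one element more; otherwise N is a
  clique of the older tree.\<close>

lemma d_tree_clique_extends:
  assumes "d_tree d V E" "N \<subseteq> V" "clique E N" "card N = d"
  shows "\<exists>w\<in>V - N. clique E (insert w N)"
  using assms
proof (induction arbitrary: N rule: d_tree.induct)
  case (complete V)
  then have "N \<noteq> V" by auto
  then obtain w where "w \<in> V - N" using complete by auto
  then show ?case using complete by (intro bexI[of _ w]) (auto simp: clique_def complete_edges_def)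
next
  case (add_vertex V E v M)
  let ?E = "E \<union> {{v, u} | u. u \<in> M}"
  have G: "fin_graph V E" using add_vertex d_tree_fin_graph by blast
  then have VE: "e \<subseteq> V" if "e \<in> E" for e using that by (auto simp: fin_graph_def)
  have M: "clique E M"
    using add_vertex G clique_iff_induced_complete[of E M] by (auto simp: fin_graph_def)
  show ?case
  proof (cases "v \<in> N")
    case False
    then have "N \<subseteq> V" using add_vertex by auto
    moreover have "clique E N"
      unfolding clique_def
    proof (intro ballI impI)
      fix x y assume xy: "x \<in> N" "y \<in> N" "x \<noteq> y"
      then have "{x, y} \<in> ?E" using add_vertex.prems by (simp add: clique_def)
      then show "{x, y} \<in> E" using xy False by (auto simp: doubleton_eq_iff)
    qed
    ultimately obtain w where "w \<in> V - N" "clique E (insert w N)"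
      using add_vertex by blast
    moreover have "E \<subseteq> ?E" by auto
    ultimately show ?thesis unfolding clique_def by blast
  next
    case True
    have NM: "N - {v} \<subseteq> M"
    proof
      fix x assume x: "x \<in> N - {v}"
      then have "x \<in> N" "v \<noteq> x" by auto
      then have "{v, x} \<in> ?E" using add_vertex.prems(2) True unfolding clique_def by blast
      then show "x \<in> M" using VE[of "{v, x}"] add_vertex.hyps x by (auto simp: doubleton_eq_iff)
    qed
    have "finite N" using add_vertex.prems G by (auto simp: fin_graph_def intro: finite_subset)
    then have "card (N - {v}) < card M"
      using True add_vertex by (metis card_Diff1_less)
    then have "N - {v} \<noteq> M" by auto
    then obtain w where w: "w \<in> M" "w \<notin> N - {v}" using NM by blast
    then have "w \<in> V - N" using add_vertex by auto
    moreover have "clique ?E (insert v M)"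
      using M by (auto simp: clique_def)
    then have "clique ?E (insert w N)"
      by (rule clique_subset) (use NM w in auto)
    ultimately show ?thesis by blast
  qed
qed

lemma card_complete_edges: "finite W \<Longrightarrow> card (complete_edges W) = card W choose 2"
  by (simp add: complete_edges_def n_subsets)

text \<open>The base case of both edge counts: a simplex on d + 1 vertices attains the
  bound.\<close>

lemma simplex_edge_count:
  "int ((d + 1) choose 2) = int d * int (d + 1) - int ((d + 1) choose 2)"
proof -
  have "2 * ((d + 1) choose 2) = d * (d + 1)" by (simp add: choose_two)
  then have "2 * int ((d + 1) choose 2) = int d * int (d + 1)"
    by (metis of_nat_mult of_nat_numeral)
  then show ?thesis by simp
qed

lemma d_tree_card_edges:
  "d_tree d V E \<Longrightarrow> int (card E) = int d * int (card V) - int ((d + 1) choose 2)"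
proof (induction rule: d_tree.induct)
  case (complete V)
  then show ?case using simplex_edge_count[of d] by (simp add: card_complete_edges)
next
  case (add_vertex V E v N)
  then have "fin_graph V E" using d_tree_fin_graph by blast
  then have "card (E \<union> {{v, u} | u. u \<in> N}) = card E + d" "card (insert v V) = card V + 1"
    using card_add_star[of V v N E] add_vertex by (auto simp: fin_graph_def)
  then show ?case using add_vertex.IH by (simp add: algebra_simps)
qed

lemma graph_connected_insert:
  assumes W: "graph_connected W F" and sub: "F \<subseteq> F'" and u: "u \<in> W" "{v, u} \<in> F'"
  shows "graph_connected (insert v W) F'"
proof -
  let ?R = "\<lambda>W F. {(x, y). x \<in> W \<and> y \<in> W \<and> {x, y} \<in> F}"
  let ?R' = "?R (insert v W) F'"
  have mono: "(?R W F)\<^sup>* \<subseteq> ?R'\<^sup>*" using sub by (intro rtrancl_mono) auto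
  have "sym ?R'" by (auto simp: sym_def insert_commute)
  then have sym: "sym (?R'\<^sup>*)" by (rule sym_rtrancl)
  have "(x, u) \<in> ?R'\<^sup>*" if "x \<in> insert v W" for x
  proof (cases "x \<in> W")
    case True
    then show ?thesis using W u mono unfolding graph_connected_def by blast
  next
    case False
    then show ?thesis using that u by auto
  qed
  then have "(x, y) \<in> ?R'\<^sup>*" if "x \<in> insert v W" "y \<in> insert v W" for x y
    using that sym by (meson rtrancl_trans symD)
  then show ?thesis by (auto simp: graph_connected_def)
qed

text \<open>Fewer than d deletions cannot remove all d neighbours of a newly attached vertex, so it
  stays linked to the older part, which is connected by induction.\<close>

lemma d_tree_k_connected: "d_tree d V E \<Longrightarrow> k_connected d V E"
proof (induction rule: d_tree.induct)
  case (complete V)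
  have "graph_connected (V - X) (induced_edges (complete_edges V) (V - X))"
    if X: "X \<subseteq> V" "card X < d" for X
  proof -
    have "X \<noteq> V" using X complete by auto
    moreover have "{x, y} \<in> induced_edges (complete_edges V) (V - X)"
      if "x \<in> V - X" "y \<in> V - X" "x \<noteq> y" for x y
      using that by (auto simp: induced_edges_def complete_edges_def)
    then have "(x, y) \<in> {(x, y). x \<in> V - X \<and> y \<in> V - X \<and>
        {x, y} \<in> induced_edges (complete_edges V) (V - X)}\<^sup>*"
      if "x \<in> V - X" "y \<in> V - X" for x y
      using that by (cases "x = y") auto
    ultimately show ?thesis using X unfolding graph_connected_def by blast
  qed
  then show ?case using complete by (simp add: k_connected_def)
next
  case (add_vertex V E v N)
  let ?E = "E \<union> {{v, u} | u. u \<in> N}"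
  have fin: "finite V" using d_tree_fin_graph[OF add_vertex.hyps(1)] by (simp add: fin_graph_def)
  have "graph_connected (insert v V - X) (induced_edges ?E (insert v V - X))"
    if X: "X \<subseteq> insert v V" "card X < d" for X
  proof (cases "v \<in> X")
    case True
    have finX: "finite X" using X fin by (auto intro: finite_subset)
    have "insert v V - X = V - (X - {v})" using True add_vertex by auto
    moreover have "induced_edges ?E (V - (X - {v})) = induced_edges E (V - (X - {v}))"
      using add_vertex by (auto simp: induced_edges_def)
    moreover have "X - {v} \<subseteq> V" "card (X - {v}) < d"
      using X finX card_Diff1_le[of X v] by auto
    ultimately show ?thesis using add_vertex.IH by (simp add: k_connected_def)
  next
    case False
    have "finite N" using add_vertex fin by (auto intro: finite_subset)
    have "\<not> N \<subseteq> X"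
      using card_mono[of X N] X add_vertex fin by (auto dest: finite_subset)
    then obtain u where u: "u \<in> N" "u \<notin> X" by blast
    have "insert v V - X = insert v (V - X)" using False by auto
    moreover have "graph_connected (V - X) (induced_edges E (V - X))"
      using add_vertex.IH X False by (auto simp: k_connected_def)
    then have "graph_connected (insert v (V - X)) (induced_edges ?E (insert v (V - X)))"
      by (rule graph_connected_insert[where u = u])
        (use u add_vertex in \<open>auto simp: induced_edges_def\<close>)
    ultimately show ?thesis by simp
  qed
  then show ?case using add_vertex fin by (auto simp: k_connected_def)
qed

text \<open>The cliques \<open>K\<close> and \<open>L\<close> are too large to be realised inside the affine hull of \<open>X\<close>.\<close>

definition clique_separation ::
    "nat \<Rightarrow> 'a set \<Rightarrow> 'a set set \<Rightarrow> 'a set \<Rightarrow> 'a set \<Rightarrow> 'a set \<Rightarrow> bool" where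
  "clique_separation d V E A B X \<longleftrightarrow>
     V = A \<union> B \<union> X \<and> A \<inter> B = {} \<and> A \<inter> X = {} \<and> B \<inter> X = {} \<and> card X < d \<and>
     (\<forall>a\<in>A. \<forall>b\<in>B. {a, b} \<notin> E) \<and>
     (\<exists>K \<subseteq> A \<union> X. clique E K \<and> card X < card K) \<and>
     (\<exists>L \<subseteq> B \<union> X. clique E L \<and> card X < card L)"

lemma clique_separation_sym:
  assumes sep: "clique_separation d V E A B X"
  shows "clique_separation d V E B A X"
proof -
  have "\<forall>b\<in>B. \<forall>a\<in>A. {b, a} \<notin> E"
    using sep unfolding clique_separation_def by (metis insert_commute)
  then show ?thesis using sep unfolding clique_separation_def by blast
qed

text \<open>The large cliques persist, so the new vertex only has to miss one side. A simplicial
  vertex always does: its neighbourhood is a clique, and no edge joins A to B.\<close>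

lemma clique_separation_insert:
  assumes sep: "clique_separation d W E A B X" and "v \<notin> W" and nb: "nbrs E W v \<inter> B = {}"
  shows "clique_separation d (insert v W) E (insert v A) B X"
proof -
  have "{v, b} \<notin> E" if "b \<in> B" for b
    using that sep nb by (auto simp: clique_separation_def nbrs_def)
  then show ?thesis using sep \<open>v \<notin> W\<close> unfolding clique_separation_def by blast
qed

text \<open>Having more elements than X, the cliques K and L reach into A and B, and no walk that
  avoids X leaves A.\<close>

lemma clique_separation_not_connected:
  assumes sep: "clique_separation d V E A B X" and "finite V"
  shows "\<not> k_connected d V E"
proof
  assume conn: "k_connected d V E"
  let ?R = "{(x, y). x \<in> V - X \<and> y \<in> V - X \<and> {x, y} \<in> induced_edges E (V - X)}"
  have fin: "finite X" using sep \<open>finite V\<close> by (auto simp: clique_separation_def)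
  have large: "\<not> K \<subseteq> X" if "card X < card K" for K
    using card_mono[OF fin, of K] that by auto
  obtain K L where "K \<subseteq> A \<union> X" "L \<subseteq> B \<union> X" "\<not> K \<subseteq> X" "\<not> L \<subseteq> X"
    using sep large unfolding clique_separation_def by metis
  then obtain a b where ab: "a \<in> A" "b \<in> B" by blast
  have "(a, b) \<in> ?R\<^sup>*"
    using conn sep ab unfolding k_connected_def graph_connected_def clique_separation_def by blast
  then have "b \<in> A"
  proof (induction rule: rtrancl_induct)
    case (step y z)
    then show ?case using sep unfolding clique_separation_def induced_edges_def by blast
  qed (rule ab)
  then show False using ab sep by (auto simp: clique_separation_def)
qed

text \<open>The vertices are added in the reverse of a perfect elimination order; the first vertex that
  is attached to too few predecessors yields the separation, which later vertices extend.\<close>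

lemma chordal_d_tree_or_separation:
  assumes "finite W" "chordal W E" and card2: "\<And>e. e \<in> E \<Longrightarrow> card e = 2"
    and "\<And>K. K \<subseteq> W \<Longrightarrow> clique E K \<Longrightarrow> card K \<le> d + 1"
  shows "(clique E W \<and> card W \<le> d) \<or> d_tree d W (induced_edges E W) \<or>
    (\<exists>A B X. clique_separation d W E A B X)"
  using assms(1,2,4)
proof (induction W rule: finite_psubset_induct)
  case (psubset W)
  show ?case
  proof (cases "W = {}")
    case True
    then show ?thesis by (simp add: clique_def)
  next
    case False
    then obtain v where v: "v \<in> W" "clique E (nbrs E W v)"
      using chordal_simplicial_exists[OF psubset.hyps psubset.prems(1) card2] by blast
    define U where "U = W - {v}"
    have W: "W = insert v U" "v \<notin> U" "U \<subset> W" "finite U"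
      using v psubset.hyps by (auto simp: U_def)
    define N where "N = nbrs E U v"
    have N: "N \<subseteq> U" "finite N" "clique E N"
      using W v clique_subset[of E "nbrs E W v" N]
      by (auto simp: N_def nbrs_def intro: finite_subset)
    have vN: "clique E (insert v N)" using N by (intro clique_insert_nbrs[of _ _ U]) (auto simp: N_def)
    have cN: "card (insert v N) = card N + 1" using N W by (subst card_insert_disjoint) auto
    then have Nd: "card N \<le> d" using psubset.prems(2)[OF _ vN] N W by auto
    have edges: "induced_edges E W = induced_edges E U \<union> {{v, u} | u. u \<in> N}"
      unfolding W N_def by (rule induced_edges_insert[OF card2 W(2)])
    \<comment> \<open>The new vertex and its neighbours form the large clique on one side; the other
      side only needs a clique L of older vertices that is larger than N.\<close>
    have split: "clique_separation d W E {v} (U - N) N"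
      if "card N < d" "clique E L" "L \<subseteq> U" "card N < card L" for L
      unfolding clique_separation_def
      using that N W vN cN by (auto simp: N_def nbrs_def intro: exI[of _ "insert v N"] exI[of _ L])
    have "chordal U E" using psubset.prems W chordal_subset by blast
    then consider "clique E U" "card U \<le> d" | "d_tree d U (induced_edges E U)" |
      A B X where "clique_separation d U E A B X"
      using psubset.IH[OF W(3)] psubset.prems(2) W by (meson psubset_imp_subset subset_trans)
    then show ?thesis
    proof cases
      \<comment> \<open>The phase before the first simplex: attaching v to all of U keeps a clique,
        which becomes the initial simplex at d + 1 vertices; otherwise U itself serves as L.\<close>
      case 1
      show ?thesis
      proof (cases "N = U")
        case True
        then have clW: "clique E W" "card W = card U + 1" using vN W by auto
        show ?thesis
        proof (cases "card W \<le> d")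
          case False
          then have "card W = d + 1" using clW 1 by simp
          then have "d_tree d W (complete_edges W)"
            using psubset.hyps by (intro d_tree.complete)
          then show ?thesis using clW clique_iff_induced_complete[OF card2] by metis
        qed (use clW in blast)
      next
        case False
        then have "card N < card U" using N W by (intro psubset_card_mono) auto
        then show ?thesis using split[of U] 1 by auto
      qed
    next
      case 2
      show ?thesis
      proof (cases "card N = d")
        case True
        have "induced_edges (induced_edges E U) N = complete_edges N"
          using N clique_iff_induced_complete[OF card2, where N = N]
          by (auto simp: induced_edges_def)
        then have "d_tree d W (induced_edges E W)"
          unfolding edges unfolding W(1) by (intro d_tree.add_vertex 2 W N True)
        then show ?thesis by blast
      next
        case False
        obtain K where K: "K \<subseteq> U" "clique (induced_edges E U) K" "card K = d + 1"
          using d_tree_clique[OF 2] by blast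
        then have "clique E K" by (auto simp: clique_def induced_edges_def)
        then show ?thesis using split[of K] K False Nd by auto
      qed
    next
      case 3
      have "N \<inter> A = {} \<or> N \<inter> B = {}"
      proof (rule ccontr)
        assume "\<not> ?thesis"
        then obtain a b where "a \<in> N" "b \<in> N" "a \<in> A" "b \<in> B" by blast
        moreover have "a \<noteq> b" using 3 calculation by (auto simp: clique_separation_def)
        ultimately show False
          using 3 N(3) unfolding clique_def clique_separation_def by blast
      qed
      then show ?thesis
        using clique_separation_insert[OF 3 W(2)]
          clique_separation_insert[OF clique_separation_sym[OF 3] W(2)]
        unfolding W(1) N_def by blast
    qed
  qed
qed

text \<open>Deleting a simplicial vertex lowers the bound by exactly d and the number of edges by
  \<open>card N \<le> d\<close>. Equality therefore forces \<open>card N = d\<close> and equality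
  for the smaller graph, so the inequality and its equality case go through one induction.\<close>

lemma chordal_edge_bound:
  assumes "finite W" "chordal W E" and card2: "\<And>e. e \<in> E \<Longrightarrow> card e = 2"
    and "\<And>K. K \<subseteq> W \<Longrightarrow> clique E K \<Longrightarrow> card K \<le> d + 1" and "card W \<ge> d + 1"
  shows "int (card (induced_edges E W)) \<le> int d * int (card W) - int ((d + 1) choose 2) \<and>
    (int (card (induced_edges E W)) = int d * int (card W) - int ((d + 1) choose 2) \<longrightarrow>
      d_tree d W (induced_edges E W))"
  using assms(1,2,4-)
proof (induction W rule: finite_psubset_induct)
  case (psubset W)
  show ?case
  proof (cases "card W = d + 1")
    case True
    have sub: "induced_edges E W \<subseteq> complete_edges W"
      using card2 by (auto simp: induced_edges_def complete_edges_def)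
    have fin: "finite (complete_edges W)" using psubset.hyps by (simp add: complete_edges_def)
    have "card (complete_edges W) = (d + 1) choose 2"
      using card_complete_edges[OF psubset.hyps] True by simp
    moreover have "d_tree d W (complete_edges W)"
      using psubset.hyps True by (intro d_tree.complete)
    ultimately show ?thesis
      using simplex_edge_count[of d] True card_mono[OF fin sub] card_subset_eq[OF fin sub] by auto
  next
    case False
    then have big: "card W \<ge> d + 2" using psubset.prems by simp
    then have "W \<noteq> {}" by auto
    then obtain v where v: "v \<in> W" "clique E (nbrs E W v)"
      using chordal_simplicial_exists[OF psubset.hyps psubset.prems(1) card2] by blast
    define U where "U = W - {v}"
    have W: "W = insert v U" "v \<notin> U" "U \<subset> W" "finite U"
      using v psubset.hyps by (auto simp: U_def)
    have cW: "card W = card U + 1" using W by simp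
    define N where "N = nbrs E U v"
    have N: "N \<subseteq> U" "finite N" "clique E N"
      using W v clique_subset[of E "nbrs E W v" N]
      by (auto simp: N_def nbrs_def intro: finite_subset)
    have vN: "clique E (insert v N)" using N by (intro clique_insert_nbrs[of _ _ U]) (auto simp: N_def)
    have "card (insert v N) = card N + 1" using N W by (subst card_insert_disjoint) auto
    then have Nd: "card N \<le> d" using psubset.prems(2)[OF _ vN] N W by auto
    have edges: "induced_edges E W = induced_edges E U \<union> {{v, u} | u. u \<in> N}"
      unfolding W N_def by (rule induced_edges_insert[OF card2 W(2)])
    have count: "card (induced_edges E W) = card (induced_edges E U) + card N"
      unfolding edges by (rule card_add_star[OF W(4,2) N(1)]) (auto simp: induced_edges_def)
    have "chordal U E" using psubset.prems W chordal_subset by blast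
    then have IH: "int (card (induced_edges E U)) \<le> int d * int (card U) - int ((d + 1) choose 2)"
      "int (card (induced_edges E U)) = int d * int (card U) - int ((d + 1) choose 2) \<Longrightarrow>
        d_tree d U (induced_edges E U)"
      using psubset.IH[OF W(3)] psubset.prems(2) W big by auto
    have step: "int d * int (card W) = int d * int (card U) + int d"
      unfolding cW by (simp add: algebra_simps)
    have "d_tree d W (induced_edges E W)"
      if "int (card (induced_edges E W)) = int d * int (card W) - int ((d + 1) choose 2)"
    proof -
      have cN: "card N = d" and "d_tree d U (induced_edges E U)"
        using that IH step count Nd by linarith+
      moreover have "induced_edges (induced_edges E U) N = complete_edges N"
        using N clique_iff_induced_complete[OF card2, where N = N]
        by (auto simp: induced_edges_def)
      ultimately show ?thesis
        unfolding edges unfolding W(1) by (intro d_tree.add_vertex W N cN)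
    qed
    then show ?thesis using IH(1) step count Nd by linarith
  qed
qed

section \<open>Isometries and regular simplices\<close>


text \<open>For weights with sum 0 and weighted point sum 0, the weighted sum of squared distances
  to p does not depend on p. With unit distances it equals minus the weight of p, so all weights
  agree and, having sum 0, vanish.\<close>

lemma unit_simplex_affine_independent:
  fixes S :: "'n::euclidean_space set"
  assumes fin: "finite S" and unit: "\<And>x y. x \<in> S \<Longrightarrow> y \<in> S \<Longrightarrow> x \<noteq> y \<Longrightarrow> dist x y = 1"
  shows "\<not> affine_dependent S"
proof
  assume "affine_dependent S"
  then obtain U v where U: "sum U S = 0" "v \<in> S" "U v \<noteq> 0" "(\<Sum>x\<in>S. U x *\<^sub>R x) = 0"
    using affine_dependent_explicit_finite[OF fin] by blast
  define c where "c = (\<Sum>x\<in>S. U x * (x \<bullet> x))"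
  have Up: "U p = - c" if p: "p \<in> S" for p
  proof -
    have "(\<Sum>x\<in>S. U x * (dist x p)\<^sup>2) = (\<Sum>x\<in>S. U x * (x \<bullet> x) - 2 * (U x *\<^sub>R x \<bullet> p) + U x * (p \<bullet> p))"
      by (rule sum.cong)
        (simp_all add: dist_norm power2_norm_eq_inner inner_diff_left inner_diff_right
          inner_commute algebra_simps)
    also have "\<dots> = c - 2 * ((\<Sum>x\<in>S. U x *\<^sub>R x) \<bullet> p) + sum U S * (p \<bullet> p)"
      by (simp add: sum.distrib sum_subtractf c_def inner_sum_left sum_distrib_left sum_distrib_right)
    finally have "(\<Sum>x\<in>S. U x * (dist x p)\<^sup>2) = c" using U by simp
    moreover have "(\<Sum>x\<in>S. U x * (dist x p)\<^sup>2) = (\<Sum>x\<in>S - {p}. U x)"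
      using fin p unit by (subst sum.remove[OF fin p]) (auto intro!: sum.cong)
    moreover have "sum U S = U p + (\<Sum>x\<in>S - {p}. U x)"
      by (rule sum.remove[OF fin p])
    ultimately show ?thesis using U by simp
  qed
  have "sum U S = - (real (card S) * c)" using Up by simp
  then have "c = 0" using U fin by auto
  then show False using Up U by simp
qed

lemma euclidean_isometry_id: "euclidean_isometry id"
  by (simp add: euclidean_isometry_def)

lemma euclidean_isometry_comp:
  "euclidean_isometry f \<Longrightarrow> euclidean_isometry g \<Longrightarrow> euclidean_isometry (g \<circ> f)"
  by (auto simp: euclidean_isometry_def intro: bij_comp)

text \<open>For distinct p and q this is the reflection in their perpendicular bisector, which
  consists of the points equidistant from both.\<close>

lemma reflection_exists:
  fixes p q :: "real ^ 'd"
  obtains g where "euclidean_isometry g" "g p = q" "\<And>x. dist x p = dist x q \<Longrightarrow> g x = x"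
proof (cases "p = q")
  case True
  then show thesis using that[OF euclidean_isometry_id] by simp
next
  case False
  define n where "n = p - q"
  define m where "m = (1/2) *\<^sub>R (p + q)"
  define g where "g x = x - (2 * ((x - m) \<bullet> n) / (n \<bullet> n)) *\<^sub>R n" for x
  have nn: "n \<bullet> n \<noteq> 0" using False by (simp add: n_def)
  have flip: "(g x - m) \<bullet> n = - ((x - m) \<bullet> n)" for x
    using nn by (simp add: g_def inner_diff_left)
  have invol: "g (g x) = x" for x
    unfolding g_def[of "g x"] flip by (simp add: g_def)
  have iso: "dist (g x) (g y) = dist x y" for x y
  proof -
    define z where "z = x - y"
    define c where "c = 2 * (z \<bullet> n) / (n \<bullet> n)"
    have "g x - g y = z - c *\<^sub>R n"
      by (simp add: g_def z_def c_def algebra_simps inner_diff_left diff_divide_distrib)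
    moreover have "(norm (z - c *\<^sub>R n))\<^sup>2 = (norm z)\<^sup>2 - c * (2 * (z \<bullet> n) - c * (n \<bullet> n))"
      unfolding power2_norm_eq_inner
      by (simp add: inner_diff_left inner_diff_right inner_commute algebra_simps)
    moreover have "c * (n \<bullet> n) = 2 * (z \<bullet> n)" using nn by (simp add: c_def)
    ultimately have "norm (g x - g y) = norm z" by simp
    then have "norm (g x - g y) = norm (x - y)" by (simp only: z_def)
    then show ?thesis by (simp add: dist_norm)
  qed
  have "(p - m) \<bullet> n = (n \<bullet> n) / 2"
    by (simp add: m_def n_def algebra_simps inner_add_left inner_diff_left inner_diff_right inner_commute)
  then have *: "2 * ((p - m) \<bullet> n) = n \<bullet> n" by simp
  have "g p = p - n" unfolding g_def * using nn by simp
  then have "g p = q" by (simp add: n_def)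
  moreover have "g x = x" if "dist x p = dist x q" for x
  proof -
    have "(norm (x - p))\<^sup>2 = (norm (x - q))\<^sup>2" using that by (simp add: dist_norm)
    then have "(x - m) \<bullet> n = 0"
      unfolding power2_norm_eq_inner
      by (simp add: m_def n_def inner_add_left inner_diff_left inner_diff_right inner_commute
          algebra_simps)
    then show ?thesis by (simp add: g_def)
  qed
  moreover have "euclidean_isometry g"
    using iso invol by (auto simp: euclidean_isometry_def intro: involuntory_imp_bij)
  ultimately show thesis using that by blast
qed

text \<open>One reflection per point: the points already placed are equidistant from the current and
  the desired image of the next one, so the reflection fixes them.\<close>

lemma isometry_extension:
  fixes \<rho> \<sigma> :: "'a \<Rightarrow> real ^ 'd"
  assumes "finite K" "\<And>x y. x \<in> K \<Longrightarrow> y \<in> K \<Longrightarrow> dist (\<rho> x) (\<rho> y) = dist (\<sigma> x) (\<sigma> y)"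
  shows "\<exists>f. euclidean_isometry f \<and> (\<forall>x\<in>K. \<sigma> x = f (\<rho> x))"
  using assms
proof (induction K rule: finite_induct)
  case empty
  show ?case using euclidean_isometry_id by auto
next
  case (insert v K)
  then obtain f where f: "euclidean_isometry f" "\<And>x. x \<in> K \<Longrightarrow> \<sigma> x = f (\<rho> x)" by auto
  obtain g where g: "euclidean_isometry g" "g (f (\<rho> v)) = \<sigma> v"
    "\<And>x. dist x (f (\<rho> v)) = dist x (\<sigma> v) \<Longrightarrow> g x = x"
    using reflection_exists[of "f (\<rho> v)" "\<sigma> v"] by metis
  have "g (f (\<rho> x)) = \<sigma> x" if "x \<in> K" for x
  proof -
    have "dist (f (\<rho> x)) (f (\<rho> v)) = dist (\<sigma> x) (\<sigma> v)"
      using insert.prems[of x v] f(1) that by (simp add: euclidean_isometry_def)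
    then show ?thesis using g(3)[of "f (\<rho> x)"] f(2)[OF that] by simp
  qed
  then have "\<forall>x\<in>insert v K. \<sigma> x = (g \<circ> f) (\<rho> x)" using g(2) by simp
  then show ?case using euclidean_isometry_comp[OF f(1) g(1)] by blast
qed

text \<open>The apexes over a facet lie on a line orthogonal to it, which meets the unit sphere around a
  vertex of the facet at most twice.\<close>

lemma unit_simplex_two_apexes:
  fixes S :: "'n::euclidean_space set"
  assumes card: "card S = DIM('n)"
    and unit: "\<And>x y. x \<in> S \<Longrightarrow> y \<in> S \<Longrightarrow> x \<noteq> y \<Longrightarrow> dist x y = 1"
    and apex: "\<And>s. s \<in> S \<Longrightarrow> dist p s = 1" "\<And>s. s \<in> S \<Longrightarrow> dist q s = 1" "\<And>s. s \<in> S \<Longrightarrow> dist r s = 1"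
    and pr: "p \<noteq> r" and qr: "q \<noteq> r"
  shows "p = q"
proof -
  have fin: "finite S" using card by (metis DIM_positive card.infinite less_irrefl)
  obtain s where s: "s \<in> S" using card by fastforce
  define D where "D = (+) (- s) ` S"
  have "int (card S) = aff_dim S + 1"
    using unit_simplex_affine_independent[OF fin unit] aff_dim_affine_independent by blast
  then have dimD: "dim D + 1 = DIM('n)"
    using card aff_dim_eq_dim[of s S] hull_inc[OF s] by (simp add: D_def)
  \<comment> \<open>Comparing the unit distance conditions at s and s' shows that two apexes differ
    by a vector orthogonal to every direction of the facet.\<close>
  have orth: "(x - r) \<bullet> y = 0" if x: "\<And>s. s \<in> S \<Longrightarrow> dist x s = 1" and y: "y \<in> span D" for x y
    using y
  proof (induction rule: span_induct_alt)
    case (step c y z)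
    then obtain s' where s': "s' \<in> S" "y = s' - s" by (auto simp: D_def)
    have "(norm (x - s'))\<^sup>2 = 1" "(norm (r - s'))\<^sup>2 = 1" "(norm (x - s))\<^sup>2 = 1" "(norm (r - s))\<^sup>2 = 1"
      using x[OF s] x[OF s'(1)] apex(3)[OF s] apex(3)[OF s'(1)] by (simp_all add: dist_norm)
    then have "(x - r) \<bullet> y = 0"
      unfolding power2_norm_eq_inner s'(2)
      by (simp add: inner_diff_left inner_diff_right inner_commute algebra_simps)
    with step show ?case by (simp add: inner_add_right)
  qed simp
  define n where "n = p - r"
  have n0: "n \<bullet> n \<noteq> 0" using pr by (simp add: n_def)
  have n_orth: "n \<bullet> y = 0" if "y \<in> span D" for y using orth[OF apex(1) that] by (simp add: n_def)
  then have "n \<notin> span D" using n0 by blast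
  then have full: "span (insert n D) = UNIV"
    using dimD by (simp add: dim_insert flip: dim_eq_full)
  define l where "l = ((q - r) \<bullet> n) / (n \<bullet> n)"
  \<comment> \<open>The part of q - r not along n. It is orthogonal to n and to D, which together
    span the space, so it vanishes.\<close>
  define e where "e = (q - r) - l *\<^sub>R n"
  have "e \<bullet> y = 0" if "y \<in> span (insert n D)" for y
    using that
  proof (induction rule: span_induct_alt)
    case (step c y z)
    have "e \<bullet> y = 0"
    proof (cases "y = n")
      case True
      then show ?thesis using n0 by (simp add: e_def l_def inner_diff_left)
    next
      case False
      then have "y \<in> span D" using step by (simp add: span_base)
      then show ?thesis using orth[OF apex(2)] n_orth by (simp add: e_def inner_diff_left)
    qed
    with step show ?case by (simp add: inner_add_right)
  qed simp
  then have "e \<bullet> e = 0" using full by blast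
  then have "e = 0" by simp
  then have q: "q = r + l *\<^sub>R n" by (simp add: e_def algebra_simps)
  have "(norm (q - s))\<^sup>2 = 1" "(norm (r - s))\<^sup>2 = 1" "(norm (p - s))\<^sup>2 = 1"
    using apex s by (simp_all add: dist_norm)
  \<comment> \<open>On the line through r in direction n, unit distance from s is a quadratic
    condition with the roots k = 0 (the point r) and k = 1 (the point p). As q differs from r, its
    parameter l is 1.\<close>
  moreover have "(norm (r + k *\<^sub>R n - s))\<^sup>2 = (norm (r - s))\<^sup>2 + k * (2 * ((r - s) \<bullet> n) + k * (n \<bullet> n))" for k
    unfolding power2_norm_eq_inner
    by (simp add: inner_add_left inner_add_right inner_diff_left inner_diff_right inner_commute
        algebra_simps)
  moreover from this[of 1] have "(norm (p - s))\<^sup>2 = (norm (r - s))\<^sup>2 + (2 * ((r - s) \<bullet> n) + (n \<bullet> n))"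
    by (simp add: n_def)
  ultimately have root: "l * (2 * ((r - s) \<bullet> n) + l * (n \<bullet> n)) = 0"
    and root1: "2 * ((r - s) \<bullet> n) = - (n \<bullet> n)"
    unfolding q by auto
  have "l * ((l - 1) * (n \<bullet> n)) = 0"
    using root unfolding root1 by (simp add: left_diff_distrib)
  moreover have "l \<noteq> 0" using q qr by auto
  ultimately have "l = 1" using n0 by simp
  then show ?thesis using q by (simp add: n_def)
qed

section \<open>Rotations and flexes that fix an affine hull\<close>

text \<open>Rotation by the angle t in the plane of u and w, with the orthogonal complement fixed.
  The last property detects genuine deformations.\<close>

lemma rotation_family:
  fixes u w :: "'n::euclidean_space"
  assumes u: "u \<bullet> u = 1" and w: "w \<bullet> w = 1" and uw: "u \<bullet> w = 0"
  obtains R :: "real \<Rightarrow> 'n \<Rightarrow> 'n"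
  where "\<And>t x y. dist (R t x) (R t y) = dist x y" "\<And>x. R 0 x = x"
    "\<And>t x. u \<bullet> x = 0 \<Longrightarrow> w \<bullet> x = 0 \<Longrightarrow> R t x = x" "\<And>x. continuous_on UNIV (\<lambda>t. R t x)"
    "\<And>a b e. \<lbrakk>e > 0; u \<bullet> a \<noteq> 0 \<or> w \<bullet> a \<noteq> 0; u \<bullet> b \<noteq> 0 \<or> w \<bullet> b \<noteq> 0\<rbrakk>
      \<Longrightarrow> \<exists>t. \<bar>t\<bar> < e \<and> dist (R t a) b \<noteq> dist a b"
proof -
  define R where "R t x = x + ((cos t - 1) * (u \<bullet> x) - sin t * (w \<bullet> x)) *\<^sub>R u
    + (sin t * (u \<bullet> x) + (cos t - 1) * (w \<bullet> x)) *\<^sub>R w" for t x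
  have wu: "w \<bullet> u = 0" using uw by (simp add: inner_commute)
  have expand: "(norm (x + \<alpha> *\<^sub>R u + \<beta> *\<^sub>R w))\<^sup>2
      = (norm x)\<^sup>2 + (2 * (\<alpha> * (u \<bullet> x) + \<beta> * (w \<bullet> x)) + \<alpha>\<^sup>2 + \<beta>\<^sup>2)" for x \<alpha> \<beta>
    unfolding power2_norm_eq_inner
    by (simp add: inner_add_left inner_add_right u w uw wu inner_commute[of x u]
        inner_commute[of x w] power2_eq_square algebra_simps)
  have norm: "norm (R t x) = norm x" for t x
  proof -
    let ?U = "u \<bullet> x" and ?W = "w \<bullet> x"
    let ?\<alpha> = "(cos t - 1) * ?U - sin t * ?W" and ?\<beta> = "sin t * ?U + (cos t - 1) * ?W"
    have "(norm (R t x))\<^sup>2 = (norm x)\<^sup>2 + (2 * (?\<alpha> * ?U + ?\<beta> * ?W) + ?\<alpha>\<^sup>2 + ?\<beta>\<^sup>2)"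
      unfolding R_def by (rule expand)
    also have "2 * (?\<alpha> * ?U + ?\<beta> * ?W) + ?\<alpha>\<^sup>2 + ?\<beta>\<^sup>2 = ((sin t)\<^sup>2 + (cos t)\<^sup>2 - 1) * (?U\<^sup>2 + ?W\<^sup>2)"
      by algebra
    finally have "(norm (R t x))\<^sup>2 = (norm x)\<^sup>2"
      using sin_cos_squared_add[of t] by (simp add: algebra_simps)
    then show ?thesis by simp
  qed
  have diff: "R t x - R t y = R t (x - y)" for t x y
    by (simp add: R_def inner_diff_right algebra_simps)
  have inner: "R t a \<bullet> b = a \<bullet> b + (cos t - 1) * ((u \<bullet> a) * (u \<bullet> b) + (w \<bullet> a) * (w \<bullet> b))
      + sin t * ((u \<bullet> a) * (w \<bullet> b) - (w \<bullet> a) * (u \<bullet> b))" for t a b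
    by (simp add: R_def inner_add_left algebra_simps)
  have moves: "\<exists>t. \<bar>t\<bar> < e \<and> dist (R t a) b \<noteq> dist a b"
    if e: "e > 0" and a: "u \<bullet> a \<noteq> 0 \<or> w \<bullet> a \<noteq> 0" and b: "u \<bullet> b \<noteq> 0 \<or> w \<bullet> b \<noteq> 0" for a b e
  proof (rule ccontr)
    assume "\<not> ?thesis"
    then have const: "dist (R t a) b = dist a b" if "\<bar>t\<bar> < e" for t using that by blast
    \<comment> \<open>Norms are preserved, so a constant distance means a constant inner product; F
      and G are its coefficients at \<open>cos t - 1\<close> and \<open>sin t\<close>. The sum of
      their squares is the product of the squared lengths of the projections of a and b to the
      plane.\<close>
    define F where "F = (u \<bullet> a) * (u \<bullet> b) + (w \<bullet> a) * (w \<bullet> b)"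
    define G where "G = (u \<bullet> a) * (w \<bullet> b) - (w \<bullet> a) * (u \<bullet> b)"
    have eq: "(cos t - 1) * F + sin t * G = 0" if "\<bar>t\<bar> < e" for t
    proof -
      have "(norm (R t a - b))\<^sup>2 = (norm (a - b))\<^sup>2" using const[OF that] by (simp add: dist_norm)
      moreover have "(norm (R t a))\<^sup>2 = (norm a)\<^sup>2" by (simp add: norm)
      ultimately have "R t a \<bullet> b = a \<bullet> b"
        unfolding power2_norm_eq_inner
        by (simp add: inner_diff_left inner_diff_right inner_commute)
      then show ?thesis by (simp add: inner F_def G_def)
    qed
    \<comment> \<open>Capping at 1 keeps the angle below pi, so its sine is positive; comparing t
      with -t then separates F from G.\<close>
    define t where "t = min (e / 2) 1"
    have t: "0 < t" "t < e" "t < pi" using e pi_gt3 by (auto simp: t_def)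
    then have sin: "sin t > 0" by (intro sin_gt_zero)
    have cos: "cos t \<noteq> 1"
    proof
      assume "cos t = 1"
      then show False using sin_cos_squared_add[of t] sin by simp
    qed
    have "(cos t - 1) * F + sin t * G = 0" "(cos t - 1) * F - sin t * G = 0"
      using eq[of t] eq[of "- t"] t by auto
    then have "F = 0" "G = 0" using sin cos by auto
    moreover have "F\<^sup>2 + G\<^sup>2 = ((u \<bullet> a)\<^sup>2 + (w \<bullet> a)\<^sup>2) * ((u \<bullet> b)\<^sup>2 + (w \<bullet> b)\<^sup>2)"
      unfolding F_def G_def by algebra
    ultimately show False using a b by (auto simp: sum_power2_eq_zero_iff)
  qed
  show thesis
  proof (rule that[of R])
    show "dist (R t x) (R t y) = dist x y" for t x y by (simp add: dist_norm diff norm)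
    show "continuous_on UNIV (\<lambda>t. R t x)" for x
      unfolding R_def by (intro continuous_intros)
    show "R 0 x = x" for x by (simp add: R_def)
    show "R t x = x" if "u \<bullet> x = 0" "w \<bullet> x = 0" for t x using that by (simp add: R_def)
  qed (rule moves)
qed

text \<open>For nonempty P the hull has dimension at most \<open>DIM('n) - 2\<close>, which leaves
  room for a rotation plane orthogonal to it. The plane must be chosen so that both a and b have
  nonzero components in it.\<close>

lemma flexing_isometries:
  fixes P :: "'n::euclidean_space set"
  assumes fin: "finite P" and card: "card P < DIM('n)"
    and a: "a \<notin> affine hull P" and b: "b \<notin> affine hull P" and ab: "a \<noteq> b"
  obtains f :: "real \<Rightarrow> 'n \<Rightarrow> 'n"
  where "\<And>t x y. dist (f t x) (f t y) = dist x y" "\<And>x. f 0 x = x"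
    "\<And>t x. x \<in> P \<Longrightarrow> f t x = x" "\<And>x. continuous_on UNIV (\<lambda>t. f t x)"
    "\<And>e. e > 0 \<Longrightarrow> \<exists>t. \<bar>t\<bar> < e \<and> dist (f t a) b \<noteq> dist a b"
proof (cases "P = {}")
  case True
  \<comment> \<open>With no point to keep fixed, a translation along a - b is used; for t > 0 it
    multiplies the distance by 1 + t.\<close>
  show thesis
  proof (rule that[of "\<lambda>t x. x + t *\<^sub>R (a - b)"])
    fix e :: real assume e: "e > 0"
    have "a + (e/2) *\<^sub>R (a - b) - b = (1 + e/2) *\<^sub>R (a - b)" by (simp add: algebra_simps)
    then have "dist (a + (e/2) *\<^sub>R (a - b)) b = (1 + e/2) * dist a b"
      using e by (simp add: dist_norm)
    then show "\<exists>t. \<bar>t\<bar> < e \<and> dist (a + t *\<^sub>R (a - b)) b \<noteq> dist a b"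
      using e ab by (intro exI[of _ "e/2"]) auto
  qed (use True in \<open>auto intro!: continuous_intros\<close>)
next
  case False
  then obtain p where p: "p \<in> P" by blast
  define L where "L = (+) (- p) ` P"
  have "int (dim L) \<le> int (card P) - 1"
    using aff_dim_eq_dim[of p P] hull_inc[OF p] aff_dim_le_card[OF fin] by (simp add: L_def)
  then have dimL: "dim L + 1 < DIM('n)" using card by linarith
  have off: "x - p \<notin> span L" if "x \<notin> affine hull P" for x
    using that affine_hull_span_gen[OF hull_inc[OF p]] unfolding L_def
    by (metis add.commute diff_add_cancel image_eqI)
  \<comment> \<open>The witness is the normalised component of x - p orthogonal to L. The last
    clause lets w be chosen orthogonal to u.\<close>
  have perp: "\<exists>z. z \<bullet> z = 1 \<and> z \<bullet> (x - p) \<noteq> 0 \<and> (\<forall>y\<in>span L. z \<bullet> y = 0) \<and>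
      (\<forall>v. (\<forall>y\<in>span L. v \<bullet> y = 0) \<longrightarrow> v \<bullet> (x - p) = 0 \<longrightarrow> v \<bullet> z = 0)"
    if x: "x \<notin> affine hull P" for x
  proof -
    obtain y z where yz: "y \<in> span L" "\<And>w. w \<in> span L \<Longrightarrow> orthogonal z w" "x - p = y + z"
      using orthogonal_subspace_decomp_exists by blast
    have z0: "z \<noteq> 0" using yz off[OF x] by auto
    have "z \<bullet> (x - p) = z \<bullet> z" using yz by (simp add: inner_add_right orthogonal_def)
    moreover have "v \<bullet> z = v \<bullet> (x - p)" if "\<forall>y\<in>span L. v \<bullet> y = 0" for v
      using yz that by (simp add: inner_add_right)
    ultimately show ?thesis
      using z0 yz(2)
      by (intro exI[of _ "(1 / norm z) *\<^sub>R z"])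
        (auto simp: orthogonal_def power2_norm_eq_inner[symmetric] power2_eq_square)
  qed
  obtain u where u: "u \<bullet> u = 1" "u \<bullet> (a - p) \<noteq> 0" "\<And>y. y \<in> span L \<Longrightarrow> u \<bullet> y = 0"
    using perp[OF a] by blast
  \<comment> \<open>If u is orthogonal to b - p, the vector that \<open>perp\<close> gives for b is
    orthogonal to u and serves as w. Otherwise any unit vector orthogonal to L and u will
    do.\<close>
  obtain w where w: "w \<bullet> w = 1" "u \<bullet> w = 0" "\<And>y. y \<in> span L \<Longrightarrow> w \<bullet> y = 0"
    "u \<bullet> (b - p) \<noteq> 0 \<or> w \<bullet> (b - p) \<noteq> 0"
  proof (cases "u \<bullet> (b - p) = 0")
    case True
    then show thesis using perp[OF b] u that by blast
  next
    case False
    have "dim (insert u L) < DIM('n)" using dimL by (simp add: dim_insert)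
    then obtain v where v: "v \<noteq> 0" "\<And>y. y \<in> span (insert u L) \<Longrightarrow> orthogonal v y"
      using orthogonal_to_subspace_exists by blast
    have sub: "span L \<subseteq> span (insert u L)" by (rule span_mono) auto
    have "v \<bullet> y = 0" if "y \<in> span L" for y
      using v(2) sub that by (auto simp: orthogonal_def)
    moreover have "u \<bullet> v = 0"
      using v(2)[of u] by (simp add: span_base orthogonal_def inner_commute)
    moreover have "((1 / norm v) *\<^sub>R v) \<bullet> ((1 / norm v) *\<^sub>R v) = 1"
      using v(1) by (simp add: power2_norm_eq_inner[symmetric] power2_eq_square)
    ultimately show thesis using False by (intro that[of "(1 / norm v) *\<^sub>R v"]) auto
  qed
  obtain R :: "real \<Rightarrow> 'n \<Rightarrow> 'n"
    where R: "\<And>t x y. dist (R t x) (R t y) = dist x y" "\<And>x. R 0 x = x"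
      "\<And>t x. u \<bullet> x = 0 \<Longrightarrow> w \<bullet> x = 0 \<Longrightarrow> R t x = x" "\<And>x. continuous_on UNIV (\<lambda>t. R t x)"
      "\<And>a b e. \<lbrakk>e > 0; u \<bullet> a \<noteq> 0 \<or> w \<bullet> a \<noteq> 0; u \<bullet> b \<noteq> 0 \<or> w \<bullet> b \<noteq> 0\<rbrakk>
        \<Longrightarrow> \<exists>t. \<bar>t\<bar> < e \<and> dist (R t a) b \<noteq> dist a b"
    by (rule rotation_family[OF u(1) w(1) w(2)], rule that)
  have shift: "dist (p + x) y = dist x (y - p)" for x y
    by (simp add: dist_norm algebra_simps)
  show thesis
  proof (rule that[of "\<lambda>t x. p + R t (x - p)"])
    show "p + R t (x - p) = x" if "x \<in> P" for t x
    proof -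
      have "x - p \<in> span L" using that by (auto simp: L_def intro!: span_base)
      then show ?thesis using R(3) u w by simp
    qed
    show "continuous_on UNIV (\<lambda>t. p + R t (x - p))" for x
      by (intro continuous_intros R(4))
    show "\<exists>t. \<bar>t\<bar> < e \<and> dist (p + R t (a - p)) b \<noteq> dist a b" if "e > 0" for e
    proof -
      have "dist a b = dist (a - p) (b - p)" by (simp add: dist_norm)
      then show ?thesis using R(5)[of e "a - p" "b - p"] u w that by (simp add: shift)
    qed
  qed (simp_all add: R dist_norm[of "_ - p"] flip: dist_norm)
qed

section \<open>Rigidity of realisations\<close>


lemma sphere_realisations_inj:
  assumes "\<rho> \<in> sphere_realisations V E"
  shows "inj_on \<rho> V"
proof (rule inj_onI, rule ccontr)
  fix x y assume "x \<in> V" "y \<in> V" "\<rho> x = \<rho> y" "x \<noteq> y"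
  then show False
    using assms unfolding sphere_realisations_def by (cases "{x, y} \<in> E") fastforce+
qed

lemma clique_image_unit:
  assumes "\<rho> \<in> sphere_realisations V E" "clique E K" "K \<subseteq> V"
    and "p \<in> \<rho> ` K" "q \<in> \<rho> ` K" "p \<noteq> q"
  shows "dist p q = 1"
proof -
  obtain x y where xy: "x \<in> K" "y \<in> K" "p = \<rho> x" "q = \<rho> y" using assms by blast
  then have "{x, y} \<in> E" using assms by (auto simp: clique_def)
  then show ?thesis using assms xy by (auto simp: sphere_realisations_def dist_norm)
qed

lemma clique_image_aff_dim:
  fixes \<rho> :: "'a \<Rightarrow> real ^ 'd"
  assumes "\<rho> \<in> sphere_realisations V E" "clique E K" "K \<subseteq> V" "finite K"
  shows "aff_dim (\<rho> ` K) = int (card K) - 1"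
proof -
  have "\<not> affine_dependent (\<rho> ` K)"
    using assms clique_image_unit[OF assms(1-3)] by (intro unit_simplex_affine_independent) auto
  then have "int (card (\<rho> ` K)) = aff_dim (\<rho> ` K) + 1"
    by (rule aff_dim_affine_independent)
  moreover have "card (\<rho> ` K) = card K"
    using inj_on_subset[OF sphere_realisations_inj[OF assms(1)] assms(3)] by (rule card_image)
  ultimately show ?thesis by simp
qed

lemma clique_off_affine_hull:
  fixes \<rho> :: "'a \<Rightarrow> real ^ 'd"
  assumes "\<rho> \<in> sphere_realisations V E" "clique E K" "K \<subseteq> V" "finite K"
    and "finite X" "card X < card K"
  shows "\<exists>a\<in>K. \<rho> a \<notin> affine hull (\<rho> ` X)"
proof (rule ccontr)
  assume "\<not> ?thesis"
  then have "\<rho> ` K \<subseteq> affine hull (\<rho> ` X)" by blast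
  then have "aff_dim (\<rho> ` K) \<le> aff_dim (\<rho> ` X)"
    using aff_dim_subset[of "\<rho> ` K" "affine hull (\<rho> ` X)"] by simp
  moreover have "aff_dim (\<rho> ` X) \<le> int (card (\<rho> ` X)) - 1"
    using \<open>finite X\<close> by (intro aff_dim_le_card) simp
  moreover have "card (\<rho> ` X) \<le> card X" using \<open>finite X\<close> by (rule card_image_le)
  ultimately show False
    using clique_image_aff_dim[OF assms(1-4)] \<open>card X < card K\<close> by simp
qed

text \<open>Stated pointwise for arbitrary maps, because a realisation is \<open>undefined\<close>
  outside its vertex set and so is not itself a realisation of an earlier stage of the tree.\<close>

lemma d_tree_realisations_equidistant:
  fixes \<rho> \<sigma> :: "'a \<Rightarrow> real ^ 'd"
  assumes "d_tree d V E" "d = CARD('d)"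
    and "\<And>v w. v \<in> V \<Longrightarrow> w \<in> V \<Longrightarrow> {v, w} \<in> E \<Longrightarrow> dist (\<rho> v) (\<rho> w) = 1 \<and> dist (\<sigma> v) (\<sigma> w) = 1"
    and "\<And>v w. v \<in> V \<Longrightarrow> w \<in> V \<Longrightarrow> v \<noteq> w \<Longrightarrow> {v, w} \<notin> E \<Longrightarrow>
      dist (\<rho> v) (\<rho> w) > 1 \<and> dist (\<sigma> v) (\<sigma> w) > 1"
  shows "\<forall>x\<in>V. \<forall>y\<in>V. dist (\<rho> x) (\<rho> y) = dist (\<sigma> x) (\<sigma> y)"
  using assms
proof (induction rule: d_tree.induct)
  case (complete V)
  show ?case
  proof (intro ballI)
    fix x y assume xy: "x \<in> V" "y \<in> V"
    show "dist (\<rho> x) (\<rho> y) = dist (\<sigma> x) (\<sigma> y)"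
    proof (cases "x = y")
      case False
      then have "{x, y} \<in> complete_edges V" using xy by (simp add: complete_edges_def)
      then show ?thesis using complete.prems(2)[OF xy] by simp
    qed simp
  qed
next
  case (add_vertex V E v N)
  let ?E = "E \<union> {{v, u} | u. u \<in> N}"
  have G: "finite V" "\<And>e. e \<in> E \<Longrightarrow> card e = 2" "\<And>e. e \<in> E \<Longrightarrow> e \<subseteq> V"
    using d_tree_fin_graph[OF add_vertex.hyps(1)] by (auto simp: fin_graph_def)
  have old: "{x, y} \<in> ?E \<longleftrightarrow> {x, y} \<in> E" if "x \<in> V" "y \<in> V" for x y
    using that add_vertex.hyps by (auto simp: doubleton_eq_iff)
  have new: "{v, y} \<in> ?E \<longleftrightarrow> y \<in> N" if "y \<in> V" for y
    using that add_vertex.hyps G(3)[of "{v, y}"] by (auto simp: doubleton_eq_iff)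
  have sep: "dist (\<rho> x) (\<rho> y) \<ge> 1 \<and> dist (\<sigma> x) (\<sigma> y) \<ge> 1"
    if "x \<in> insert v V" "y \<in> insert v V" "x \<noteq> y" for x y
    using add_vertex.prems(2,3)[of x y] that by (cases "{x, y} \<in> ?E") force+
  have IH: "\<forall>x\<in>V. \<forall>y\<in>V. dist (\<rho> x) (\<rho> y) = dist (\<sigma> x) (\<sigma> y)"
  proof (rule add_vertex.IH[OF add_vertex.prems(1)])
    show "dist (\<rho> x) (\<rho> y) = 1 \<and> dist (\<sigma> x) (\<sigma> y) = 1" if "x \<in> V" "y \<in> V" "{x, y} \<in> E" for x y
      using add_vertex.prems(2)[of x y] old[of x y] that by blast
    show "dist (\<rho> x) (\<rho> y) > 1 \<and> dist (\<sigma> x) (\<sigma> y) > 1"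
      if "x \<in> V" "y \<in> V" "x \<noteq> y" "{x, y} \<notin> E" for x y
      using add_vertex.prems(3)[of x y] old[of x y] that by blast
  qed
  obtain f where f: "euclidean_isometry f" "\<And>x. x \<in> V \<Longrightarrow> \<sigma> x = f (\<rho> x)"
    using isometry_extension[OF G(1), of \<rho> \<sigma>] IH by blast
  have iso: "dist (f x) (f y) = dist x y" for x y using f(1) by (simp add: euclidean_isometry_def)
  have clN: "clique E N"
    using clique_iff_induced_complete[of E N] G(2) add_vertex.hyps by blast
  then obtain w where w: "w \<in> V - N" "clique E (insert w N)"
    using d_tree_clique_extends[OF add_vertex.hyps(1,3) clN add_vertex.hyps(4)] by blast
  have wv: "w \<noteq> v" using w add_vertex.hyps by auto
  have injN: "inj_on \<sigma> N"
    using sep add_vertex.hyps(3) by (intro inj_onI) (metis dist_self insertCI not_one_le_zero subsetD)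
  have unit: "dist (\<sigma> x) (\<sigma> y) = 1" if "{x, y} \<in> E" for x y
    using add_vertex.prems(2)[of x y] G(3)[OF that] that by auto
  \<comment> \<open>Three apexes over the image of N: the two candidates for v and the older vertex
    w. Non-overlap keeps both candidates away from w, so they coincide.\<close>
  have "f (\<rho> v) = \<sigma> v"
  proof (rule unit_simplex_two_apexes[of "\<sigma> ` N" _ _ "\<sigma> w"])
    show "card (\<sigma> ` N) = DIM(real ^ 'd)"
      using card_image[OF injN] add_vertex by simp
    show "dist p q = 1" if pq: "p \<in> \<sigma> ` N" "q \<in> \<sigma> ` N" "p \<noteq> q" for p q
    proof -
      obtain x y where "x \<in> N" "y \<in> N" "x \<noteq> y" "p = \<sigma> x" "q = \<sigma> y" using pq by blast
      then show ?thesis using clN unit by (simp add: clique_def)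
    qed
    show "dist (\<sigma> w) s = 1" if "s \<in> \<sigma> ` N" for s
      using that w unit by (auto simp: clique_def)
    show "dist (\<sigma> v) s = 1" if "s \<in> \<sigma> ` N" for s
      using that add_vertex.prems(2)[of v] add_vertex.hyps(3) new by auto
    show "dist (f (\<rho> v)) s = 1" if s: "s \<in> \<sigma> ` N" for s
    proof -
      obtain u where u: "u \<in> N" "s = \<sigma> u" using s by blast
      then have "s = f (\<rho> u)" using f(2) add_vertex.hyps(3) by blast
      then show ?thesis
        using u(1) add_vertex.prems(2)[of v u] add_vertex.hyps(3) new[of u] iso by auto
    qed
    show "\<sigma> v \<noteq> \<sigma> w" using sep[of v w] w wv by auto
    have "dist (f (\<rho> v)) (\<sigma> w) \<ge> 1" using sep[of v w] w wv iso f(2)[of w] by auto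
    then show "f (\<rho> v) \<noteq> \<sigma> w" by auto
  qed
  then have "\<sigma> x = f (\<rho> x)" if "x \<in> insert v V" for x using that f(2) by auto
  then show ?case using iso by simp
qed

lemma d_tree_globally_rigid:
  fixes V :: "'a set"
  assumes "d_tree d V E" "d = CARD('d::finite)" "sphere_graph TYPE('d) V E"
  shows "globally_sphere_rigid TYPE('d) V E"
proof -
  let ?S = "sphere_realisations V E :: ('a \<Rightarrow> real ^ 'd) set"
  have fin: "finite V" using d_tree_fin_graph[OF assms(1)] by (simp add: fin_graph_def)
  obtain \<rho> where \<rho>: "\<rho> \<in> ?S" using assms(3) by (auto simp: sphere_graph_def)
  have cong: "(\<sigma>, \<tau>) \<in> congruence_rel V E" if "\<sigma> \<in> ?S" "\<tau> \<in> ?S" for \<sigma> \<tau>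
  proof -
    have "\<forall>x\<in>V. \<forall>y\<in>V. dist (\<sigma> x) (\<sigma> y) = dist (\<tau> x) (\<tau> y)"
      by (rule d_tree_realisations_equidistant[OF assms(1,2)])
        (use that in \<open>auto simp: sphere_realisations_def dist_norm\<close>)
    then show ?thesis
      using isometry_extension[OF fin, of \<sigma> \<tau>] that by (auto simp: congruence_rel_def)
  qed
  have "realisation_classes V E = {?S}"
    using \<rho> cong by (auto simp: realisation_classes_def quotient_def congruence_rel_def)
  then show ?thesis using assms(3) by (simp add: globally_sphere_rigid_def)
qed

text \<open>Congruent realisations have the same value of \<open>dist (\<sigma> a) (\<sigma> b)\<close>, so finitely many classes
  would force this distance to be constant along a continuous flex.\<close>

lemma clique_separation_not_rigid:
  fixes V :: "'a set" and E :: "'a set set"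
  assumes sep: "clique_separation CARD('d::finite) V E A B X" and fin: "finite V"
  shows "\<not> sphere_rigid TYPE('d) V E"
proof
  let ?S = "sphere_realisations V E :: ('a \<Rightarrow> real ^ 'd) set"
  assume rigid: "sphere_rigid TYPE('d) V E"
  then obtain \<rho> where \<rho>: "\<rho> \<in> ?S" by (auto simp: sphere_rigid_def sphere_graph_def)
  have finQ: "finite (realisation_classes V E :: ('a \<Rightarrow> real ^ 'd) set set)"
    using rigid by (simp add: sphere_rigid_def)
  have V: "V = A \<union> B \<union> X" and disj: "A \<inter> B = {}" "A \<inter> X = {}" "B \<inter> X = {}"
    and cX: "card X < CARD('d)" and noedge: "\<And>a b. a \<in> A \<Longrightarrow> b \<in> B \<Longrightarrow> {a, b} \<notin> E"
    using sep by (auto simp: clique_separation_def)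
  obtain K L where KL: "K \<subseteq> A \<union> X" "clique E K" "card X < card K"
    "L \<subseteq> B \<union> X" "clique E L" "card X < card L"
    using sep unfolding clique_separation_def by blast
  have finX: "finite X" "finite A" "finite B" using fin V by auto
  have hull: "\<rho> x \<in> affine hull (\<rho> ` X)" if "x \<in> X" for x using that by (simp add: hull_inc)
  have "\<exists>a\<in>K. \<rho> a \<notin> affine hull (\<rho> ` X)" "\<exists>b\<in>L. \<rho> b \<notin> affine hull (\<rho> ` X)"
    using KL V finX
    by (auto intro!: clique_off_affine_hull[OF \<rho>] intro: finite_subset[of K "A \<union> X"]
        finite_subset[of L "B \<union> X"])
  \<comment> \<open>Vertices of X lie on the hull, so those found in K and L belong to A and
    B.\<close>
  then obtain a b where ab: "a \<in> A" "b \<in> B" "\<rho> a \<notin> affine hull (\<rho> ` X)" "\<rho> b \<notin> affine hull (\<rho> ` X)"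
    using KL hull by blast
  have "\<rho> a \<noteq> \<rho> b"
    using inj_onD[OF sphere_realisations_inj[OF \<rho>], of a b] ab disj V by auto
  moreover have "card (\<rho> ` X) < DIM(real ^ 'd)"
    using card_image_le[OF finX(1), of \<rho>] cX by simp
  moreover have "finite (\<rho> ` X)" using finX by simp
  ultimately obtain f :: "real \<Rightarrow> real ^ 'd \<Rightarrow> real ^ 'd"
    where iso: "\<And>t x y. dist (f t x) (f t y) = dist x y" and f0: "\<And>x. f 0 x = x"
      and fixX: "\<And>t x. x \<in> \<rho> ` X \<Longrightarrow> f t x = x" and cont: "\<And>x. continuous_on UNIV (\<lambda>t. f t x)"
      and moves: "\<And>e. e > 0 \<Longrightarrow> \<exists>t. \<bar>t\<bar> < e \<and> dist (f t (\<rho> a)) (\<rho> b) \<noteq> dist (\<rho> a) (\<rho> b)"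
    using ab(3,4) by - (rule flexing_isometries, assumption+, rule that)
  define g where "g t v = (if v \<in> A then f t (\<rho> v) else \<rho> v)" for t v
  have real1: "dist (\<rho> v) (\<rho> w) = 1" if "v \<in> V" "w \<in> V" "{v, w} \<in> E" for v w
    using \<rho> that by (simp add: sphere_realisations_def dist_norm)
  have real2: "dist (\<rho> v) (\<rho> w) > 1" if "v \<in> V" "w \<in> V" "v \<noteq> w" "{v, w} \<notin> E" for v w
    using \<rho> that by (simp add: sphere_realisations_def dist_norm)
  have contd: "continuous_on UNIV (\<lambda>t. dist (f t x) y)" for x y
    by (intro continuous_intros cont)
  have "\<forall>\<^sub>F t in nhds 0. \<forall>v\<in>A. \<forall>w\<in>B. dist (f t (\<rho> v)) (\<rho> w) > 1"
  \<comment> \<open>Pairs across the cut are never in contact and there are finitely many, so the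
    strict inequalities at t = 0 persist nearby.\<close>
  proof (intro eventually_ball_finite finX ballI)
    fix v w assume vw: "v \<in> A" "w \<in> B"
    then have "dist (f 0 (\<rho> v)) (\<rho> w) > 1"
      using real2[of v w] noedge V disj by (auto simp: f0)
    moreover have "isCont (\<lambda>t. dist (f t (\<rho> v)) (\<rho> w)) 0"
      using contd by (simp add: continuous_on_eq_continuous_at)
    then have "((\<lambda>t. dist (f t (\<rho> v)) (\<rho> w)) \<longlongrightarrow> dist (f 0 (\<rho> v)) (\<rho> w)) (nhds 0)"
      by (simp add: continuous_at tendsto_nhds_iff)
    ultimately show "\<forall>\<^sub>F t in nhds 0. dist (f t (\<rho> v)) (\<rho> w) > 1"
      by (rule order_tendstoD(1)[rotated])
  qed
  then obtain e where e: "e > 0"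
    and far: "\<And>t v w. \<bar>t\<bar> < e \<Longrightarrow> v \<in> A \<Longrightarrow> w \<in> B \<Longrightarrow> dist (f t (\<rho> v)) (\<rho> w) > 1"
    unfolding eventually_nhds_metric by (auto simp: dist_real_def)
  have same: "dist (g t v) (g t w) = dist (\<rho> v) (\<rho> w)"
    if vw: "v \<in> V" "w \<in> V" "\<not> (v \<in> A \<and> w \<in> B)" "\<not> (v \<in> B \<and> w \<in> A)" for t v w
  proof -
    consider "v \<in> A" "w \<in> A" | "v \<in> A" "w \<in> X" | "v \<in> X" "w \<in> A" | "v \<notin> A" "w \<notin> A"
      using vw V by blast
    then show ?thesis
    proof cases
      case 2
      then show ?thesis using iso[of t "\<rho> v" "\<rho> w"] fixX[of "\<rho> w" t] disj by (auto simp: g_def)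
    next
      case 3
      then show ?thesis using iso[of t "\<rho> v" "\<rho> w"] fixX[of "\<rho> v" t] disj by (auto simp: g_def)
    qed (simp_all add: g_def iso)
  qed
  have gS: "g t \<in> ?S" if t: "\<bar>t\<bar> < e" for t
  proof -
    have "({v, w} \<in> E \<longrightarrow> dist (g t v) (g t w) = 1) \<and>
        (v \<noteq> w \<and> {v, w} \<notin> E \<longrightarrow> dist (g t v) (g t w) > 1)" if "v \<in> V" "w \<in> V" for v w
    proof (cases "v \<in> A \<and> w \<in> B \<or> v \<in> B \<and> w \<in> A")
      case True
      then have "{v, w} \<notin> E" using noedge by (metis insert_commute)
      moreover have "dist (g t v) (g t w) > 1"
        using True far[OF t, of v w] far[OF t, of w v] disj by (auto simp: g_def dist_commute)
      ultimately show ?thesis by simp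
    next
      case False
      then show ?thesis using same[of v w t] real1 real2 that by auto
    qed
    moreover have "g t \<in> V \<rightarrow>\<^sub>E UNIV"
      using \<rho> V by (auto simp: g_def sphere_realisations_def PiE_def extensional_def)
    ultimately show ?thesis by (simp add: sphere_realisations_def dist_norm)
  qed
  \<comment> \<open>The representative is arbitrary: congruent realisations give the same
    value.\<close>
  define h :: "('a \<Rightarrow> real ^ 'd) set \<Rightarrow> real"
    where "h C = dist ((SOME \<sigma>. \<sigma> \<in> C) a) ((SOME \<sigma>. \<sigma> \<in> C) b)" for C
  define D where "D = (\<lambda>t. dist (f t (\<rho> a)) (\<rho> b)) ` {-e<..<e}"
  have "D \<subseteq> h ` realisation_classes V E"
  proof
    fix y assume "y \<in> D"
    then obtain t where "t \<in> {-e<..<e}" and y: "y = dist (f t (\<rho> a)) (\<rho> b)" by (auto simp: D_def)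
    then have t: "\<bar>t\<bar> < e" by auto
    let ?C = "congruence_rel V E `` {g t} :: ('a \<Rightarrow> real ^ 'd) set"
    have "g t \<in> ?C" using equiv_class_self[OF equiv_congruence_rel gS[OF t]] .
    then have "(SOME \<sigma>. \<sigma> \<in> ?C) \<in> ?C" by (rule someI[of "\<lambda>\<sigma>. \<sigma> \<in> ?C"])
    then have "h ?C = dist (g t a) (g t b)"
      using ab V unfolding h_def by (auto simp: congruence_rel_def euclidean_isometry_def)
    then have "y = h ?C" using y ab disj by (auto simp: g_def)
    then show "y \<in> h ` realisation_classes V E"
      using quotientI[OF gS[OF t]] by (auto simp: realisation_classes_def)
  qed
  then have "finite D" using finQ by (meson finite_imageI finite_subset)
  moreover have "connected D"
    unfolding D_def
    by (intro connected_continuous_image continuous_on_subset[OF contd]) auto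
  moreover have "D \<noteq> {}" using e by (auto simp: D_def)
  ultimately obtain c where "D = {c}" using connected_finite_iff_sing by blast
  then have const: "dist (f t (\<rho> a)) (\<rho> b) = c" if "\<bar>t\<bar> < e" for t
    using that by (auto simp: D_def abs_less_iff)
  \<comment> \<open>The radius e was fixed before, hence the need for changes at arbitrarily small
    t. The value at t = 0 identifies c as the original distance.\<close>
  show False using moves[OF e] const const[of 0] e f0 by auto
qed

theorem theorem2p6:
  fixes V :: "'a set" and E :: "'a set set" and d :: nat
  assumes "d = CARD('d::finite)" and "d \<in> {1, 2, 3}"
    and "fin_graph V E" and "chordal V E"
    and "sphere_graph TYPE('d) V E"
    and "card V \<ge> d + 1"
  shows "(globally_sphere_rigid TYPE('d) V E \<longleftrightarrow> sphere_rigid TYPE('d) V E) \<and>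
         (sphere_rigid TYPE('d) V E \<longleftrightarrow> k_connected d V E) \<and>
         (k_connected d V E \<longleftrightarrow> int (card E) = int d * int (card V) - int ((d + 1) choose 2)) \<and>
         (int (card E) = int d * int (card V) - int ((d + 1) choose 2) \<longleftrightarrow> d_tree d V E)"
proof -
  have fin: "finite V" and card2: "\<And>e. e \<in> E \<Longrightarrow> card e = 2" and E: "induced_edges E V = E"
    using assms(3) by (auto simp: fin_graph_def induced_edges_def)
  obtain \<rho> :: "'a \<Rightarrow> real ^ 'd" where \<rho>: "\<rho> \<in> sphere_realisations V E"
    using assms(5) by (auto simp: sphere_graph_def)
  \<comment> \<open>A clique on m vertices spans dimension m - 1, which cannot exceed d.\<close>
  have clique_bound: "card K \<le> d + 1" if "K \<subseteq> V" "clique E K" for K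
  proof -
    have "int (card K) - 1 \<le> int DIM(real ^ 'd)"
      using clique_image_aff_dim[OF \<rho> that(2,1) finite_subset[OF that(1) fin]]
        aff_dim_le_DIM[of "\<rho> ` K"] by simp
    then show ?thesis using assms(1) by simp
  qed
  \<comment> \<open>The remaining alternative, a clique on at most d vertices, contradicts
    \<open>card V \<ge> d + 1\<close>.\<close>
  consider "d_tree d V E" | A B X where "clique_separation d V E A B X"
    using chordal_d_tree_or_separation[OF fin assms(4) card2 clique_bound] E assms(6) by force
  then have cases: "d_tree d V E \<or> (\<not> k_connected d V E \<and> \<not> sphere_rigid TYPE('d) V E)"
    using clique_separation_not_connected[OF _ fin] clique_separation_not_rigid[OF _ fin]
      assms(1) by metis
  have "globally_sphere_rigid TYPE('d) V E \<Longrightarrow> sphere_rigid TYPE('d) V E"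
    by (auto simp: globally_sphere_rigid_def sphere_rigid_def intro: card_ge_0_finite)
  moreover have "int (card E) = int d * int (card V) - int ((d + 1) choose 2) \<Longrightarrow> d_tree d V E"
    using chordal_edge_bound[OF fin assms(4) card2 clique_bound assms(6)] E by simp
  moreover have "d_tree d V E \<Longrightarrow> globally_sphere_rigid TYPE('d) V E"
    using d_tree_globally_rigid assms(1,5) by blast
  \<comment> \<open>The equivalences all pass through the d-tree, which implies each of the other
    four conditions and follows from each.\<close>
  ultimately show ?thesis
    using cases d_tree_k_connected[of d V E] d_tree_card_edges[of d V E] by blast
qed

end
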